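(* Let $f(x)\in K[x]$, let $c\in K$ be non-zero, and consider the curves $\mathcal C: y^n=f(x)$ and $\mathcal C': y^n=c\,f(x)$. For $d\mid n$ let $\mathcal C_d: y^d=f(x)$ and $\mathcal C_d': y^d=c\,f(x)$ be the corresponding quotient curves. Let $L=K[\sqrt[n]{c}]$, let $r=[L:K]$, and let $V_\ell^{(i)}(\mathrm{Jac}(\mathcal C_d))^{d\text{-new}}$ and $V_\ell^{(i)}(\mathrm{Jac}(\mathcal C_d'))^{d\text{-new}}$ denote the subspaces of the $d$-new parts on which $t$ acts as $\zeta_d^i$ (see the context). Let $\sigma\in\mathrm{Gal}(L/K)$ be the generator sending $\sqrt[n]{c}$ to $\zeta_n^{n/r}\sqrt[n]{c}$, and let $\chi:\mathrm{Gal}(L/K)\to\overline{\mathbb Q_\ell}$ denote the character sending $\sigma$ to $\zeta_n^{n/r}$. Then for all $1\le i\le n$ prime to $n$ we have $$V_\ell^{(i)}(\mathrm{Jac}(\mathcal C_d))^{d\text{-new}}\simeq V_\ell^{(i)}(\mathrm{Jac}(\mathcal C_d'))^{d\text{-new}}\otimes\chi^i .$$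
   Context: $K$ is the fraction field of a complete discrete valuation ring with residue field of characteristic $p$; $n$ is a positive integer with $p\nmid n$; $K$ contains a fixed primitive $n$-th root of unity $\zeta_n$, and roots of unity are chosen compatibly, so $\zeta_d=\zeta_n^{n/d}$ for $d\mid n$. The polynomial $f$ has nonzero discriminant and all its roots lie in $K$. $\ell\neq p$ is a prime. The chosen root of unity $\zeta_n$ is also regarded as an element of $\overline{\mathbb Q_\ell}$. For a curve, $V_\ell(\mathrm{Jac})=T_\ell(\mathrm{Jac})\otimes_{\mathbb Z_\ell}\mathbb Q_\ell$ is the rational $\ell$-adic Tate module of its Jacobian, with its action of $\mathrm{Gal}(\overline K/K)$. A generator $t$ of the group $\mu_n$ acts on $\mathcal C$ by $t\cdot(x,y)=(x,\zeta_n y)$. For $d\mid n$, the curve $\mathcal C_d$ is the quotient of $\mathcal C$ by $\mu_{n/d}$, via $(x,y)\mapsto(x,y^{n/d})$, so $t$ acts on $\mathcal C_d$ by $(x,y)\mapsto(x,\zeta_d y)$. This induces an action of $t$ on $V_\ell(\mathrm{Jac}(\mathcal C))$ and $V_\ell(\mathrm{Jac}(\mathcal C_d))$ through the endomorphisms of the Jacobians; it commutes with Galois because $\zeta_n\in K$. There is a decomposition $V_\ell(\mathrm{Jac}(\mathcal C))=\bigoplus_{d\mid n}V_\ell(\mathrm{Jac}(\mathcal C_d))^{d\text{-new}}$, where the $d$-new part is the subspace on which $\mathbb Q_\ell[t]/\phi_d(t)$ acts, that is, on which $\phi_d(t)=0$, with $\phi_d$ the $d$-th cyclotomic polynomial.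 The $d$-new part decomposes further (with scalars extended to contain the $d$-th roots of unity) as a Galois module: $$V_\ell(\mathrm{Jac}(\mathcal C_d))^{d\text{-new}}=\bigoplus_{1\le i\le d,\ \gcd(i,d)=1}V_\ell^{(i)}(\mathrm{Jac}(\mathcal C_d))^{d\text{-new}},$$ where $t$ acts on $V_\ell^{(i)}$ as $\zeta_d^i$. The same definitions apply to $\mathcal C'$ and $\mathcal C_d'$. The character $\chi$ is viewed as a character of $\mathrm{Gal}(\overline K/K)$ through the quotient $\mathrm{Gal}(L/K)$, and the isomorphism is one of Galois representations.
   Formalization: The twist is by χ^{i·n/d} instead of χ^i (the same for d = n), since the printed exponent fails for proper divisors d, e.g. K = Q_5, n = 4, d = 2, i = 1, c = 5, f = x^3 − x; t acts on Jacobians by pullback, and f is taken non-constant. *)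

theory Defs
  imports
    "HOL-Algebra.Algebra"
    "HOL-Algebra.Algebraic_Closure_Type"
    "HOL-Computational_Algebra.Computational_Algebra"
    "Subresultants.Resultant_Prelim"
    "Berlekamp_Zassenhaus.Finite_Field"
begin

section \<open>Fields, valuations, Galois groups\<close>

definition discrete_valuation :: "('a, 'm) ring_scheme \<Rightarrow> ('a \<Rightarrow> int) \<Rightarrow> bool" where
  "discrete_valuation F v \<longleftrightarrow>
     (\<forall>x \<in> carrier F - {\<zero>\<^bsub>F\<^esub>}. \<forall>y \<in> carrier F - {\<zero>\<^bsub>F\<^esub>}.
        v (x \<otimes>\<^bsub>F\<^esub> y) = v x + v y \<and>
        (x \<oplus>\<^bsub>F\<^esub> y \<noteq> \<zero>\<^bsub>F\<^esub> \<longrightarrow> min (v x) (v y) \<le> v (x \<oplus>\<^bsub>F\<^esub> y))) \<and>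
     v ` (carrier F - {\<zero>\<^bsub>F\<^esub>}) = UNIV"

text \<open>A valuation is only meaningful on nonzero elements; \<open>x = 0\<close> is read as valuation infinity.
  A field carrying such a \<open>v\<close> is the fraction field of the complete discrete valuation ring
  \<open>{x. x = 0 \<or> 0 \<le> v x}\<close>.\<close>

definition complete_discrete_valuation :: "('k::field \<Rightarrow> int) \<Rightarrow> bool" where
  "complete_discrete_valuation v \<longleftrightarrow>
     discrete_valuation (ring_of_type_algebra :: 'k ring) v \<and>
     (\<forall>s :: nat \<Rightarrow> 'k.
        (\<forall>N. \<exists>M. \<forall>i\<ge>M. \<forall>j\<ge>M. s i = s j \<or> N \<le> v (s i - s j)) \<longrightarrow>
        (\<exists>x. \<forall>N. \<exists>M. \<forall>i\<ge>M. s i = x \<or> N \<le> v (s i - x)))"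

definition residue_characteristic :: "('k::field \<Rightarrow> int) \<Rightarrow> nat \<Rightarrow> bool" where
  "residue_characteristic v p \<longleftrightarrow>
     (\<forall>m::nat. (of_nat m = (0::'k) \<or> 0 < v (of_nat m)) \<longleftrightarrow> p dvd m)"

definition primitive_root_of_unity :: "nat \<Rightarrow> 'a::field \<Rightarrow> bool" where
  "primitive_root_of_unity n z \<longleftrightarrow> z ^ n = 1 \<and> (\<forall>k. 0 < k \<and> k < n \<longrightarrow> z ^ k \<noteq> 1)"

text \<open>The power of the leading coefficient corrects for \<open>pderiv f\<close> having degree smaller than
  \<open>degree f - 1\<close> in positive characteristic: the discriminant is defined by the Sylvester
  determinant in which \<open>pderiv f\<close> has formal degree \<open>degree f - 1\<close>.\<close>

definition discriminant :: "'k::field poly \<Rightarrow> 'k" where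
  "discriminant f =
     (let m = degree f; a = lead_coeff f in
      (-1) ^ (m * (m - 1) div 2) * a ^ (m - 1 - degree (pderiv f))
        * resultant f (pderiv f) / a)"

definition galois_group :: "('a, 'm) ring_scheme \<Rightarrow> 'a set \<Rightarrow> ('a \<Rightarrow> 'a) monoid" where
  "galois_group E k =
     (BijGroup (carrier E))\<lparr>carrier :=
        {\<sigma> \<in> Bij (carrier E). \<sigma> \<in> Ring.ring_hom E E \<and> (\<forall>a\<in>k. \<sigma> a = a)}\<rparr>"

text \<open>The image of \<open>K\<close> in its algebraic closure. As every automorphism of the algebraic closure is
  determined by its restriction to the separable closure, \<open>absolute_galois_group\<close> is the absolute
  Galois group of \<open>K\<close> also in positive characteristic.\<close>

definition base_field :: "'k::field alg_closure set" where
  "base_field = range to_ac"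

definition absolute_galois_group :: "('k::field alg_closure \<Rightarrow> 'k alg_closure) monoid" where
  "absolute_galois_group = galois_group ring_of_type_algebra base_field"

definition adjoin :: "'k::field alg_closure \<Rightarrow> 'k alg_closure set" where
  "adjoin x = ring.simple_extension ring_of_type_algebra base_field x"

definition extension_degree :: "'k::field alg_closure set \<Rightarrow> nat" where
  "extension_degree L = ring.dim ring_of_type_algebra base_field L"

definition relative_galois_group ::
    "'k::field alg_closure set \<Rightarrow> ('k alg_closure \<Rightarrow> 'k alg_closure) monoid" where
  "relative_galois_group L = galois_group (ring_of_type_algebra\<lparr>carrier := L\<rparr>) base_field"

section \<open>The \<open>\<ell>\<close>-adic numbers\<close>

text \<open>The prime \<open>\<ell>\<close> is the cardinality of the type \<open>'l\<close>. An \<open>\<ell>\<close>-adic integer is the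
  compatible sequence of its residues modulo the powers of \<open>\<ell>\<close>.\<close>

lemma card_prime_pos: "0 < int CARD('l::prime_card)"
  using prime_card_int[where 'a='l] by (rule prime_gt_0_int)

typedef (overloaded) 'l::prime_card ladic_int =
  "{a :: nat \<Rightarrow> int. \<forall>n. 0 \<le> a n \<and> a n < int CARD('l) ^ n \<and>
       a (Suc n) mod int CARD('l) ^ n = a n}"
  morphisms ladic_residue Abs_ladic_int
  by (rule exI[of _ "\<lambda>_. 0"]) (simp add: card_prime_pos)

setup_lifting type_definition_ladic_int

lemma ladic_reduce:
  fixes x y :: int
  assumes "y mod int CARD('l::prime_card) ^ n = x mod int CARD('l) ^ n"
  shows "0 \<le> x mod int CARD('l) ^ n \<and> x mod int CARD('l) ^ n < int CARD('l) ^ n \<and>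
         y mod int CARD('l) ^ Suc n mod int CARD('l) ^ n = x mod int CARD('l) ^ n"
proof (intro conjI)
  have pos: "0 < int CARD('l) ^ n"
    by (rule zero_less_power) (rule card_prime_pos)
  show "0 \<le> x mod int CARD('l) ^ n" "x mod int CARD('l) ^ n < int CARD('l) ^ n"
    by (rule pos_mod_sign[OF pos], rule pos_mod_bound[OF pos])
  show "y mod int CARD('l) ^ Suc n mod int CARD('l) ^ n = x mod int CARD('l) ^ n"
    using mod_mod_cancel[of "int CARD('l) ^ n" "int CARD('l) ^ Suc n" y] assms
    by (simp add: le_imp_power_dvd)
qed

lemma ladic_compatible:
  fixes a :: "nat \<Rightarrow> int"
  assumes "\<And>n. 0 \<le> a n \<and> a n < q ^ n \<and> a (Suc n) mod q ^ n = a n"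
  shows "a (Suc n) mod q ^ n = a n mod q ^ n"
  using assms[of n] by (metis mod_mod_trivial)

instantiation ladic_int :: (prime_card) comm_ring_1
begin

lift_definition zero_ladic_int :: "'a ladic_int" is "\<lambda>_. 0"
  by (simp add: card_prime_pos)

lift_definition one_ladic_int :: "'a ladic_int" is "\<lambda>n. 1 mod int CARD('a) ^ n"
  by (intro ladic_reduce refl)

lift_definition plus_ladic_int :: "'a ladic_int \<Rightarrow> 'a ladic_int \<Rightarrow> 'a ladic_int"
  is "\<lambda>a b n. (a n + b n) mod int CARD('a) ^ n"
  by (intro ladic_reduce mod_add_cong; rule ladic_compatible; assumption)

lift_definition uminus_ladic_int :: "'a ladic_int \<Rightarrow> 'a ladic_int"
  is "\<lambda>a n. (- a n) mod int CARD('a) ^ n"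
  by (intro ladic_reduce mod_minus_cong; rule ladic_compatible; assumption)

lift_definition minus_ladic_int :: "'a ladic_int \<Rightarrow> 'a ladic_int \<Rightarrow> 'a ladic_int"
  is "\<lambda>a b n. (a n - b n) mod int CARD('a) ^ n"
  by (intro ladic_reduce mod_diff_cong; rule ladic_compatible; assumption)

lift_definition times_ladic_int :: "'a ladic_int \<Rightarrow> 'a ladic_int \<Rightarrow> 'a ladic_int"
  is "\<lambda>a b n. (a n * b n) mod int CARD('a) ^ n"
  by (intro ladic_reduce mod_mult_cong; rule ladic_compatible; assumption)

instance
proof
  fix a b c :: "'a ladic_int"
  show "a * b * c = a * (b * c)"
    by transfer (auto simp: fun_eq_iff mod_simps mult.assoc)
  show "a * b = b * a"
    by transfer (auto simp: fun_eq_iff mult.commute)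
  show "1 * a = a"
    by transfer (auto simp: fun_eq_iff mod_simps)
  show "a + b + c = a + (b + c)"
    by transfer (auto simp: fun_eq_iff mod_simps add.assoc)
  show "a + b = b + a"
    by transfer (auto simp: fun_eq_iff add.commute)
  show "0 + a = a"
    by transfer (auto simp: fun_eq_iff)
  show "- a + a = 0"
    by transfer (auto simp: fun_eq_iff mod_simps)
  show "a - b = a + - b"
    by transfer (auto simp: fun_eq_iff mod_simps)
  show "(a + b) * c = a * c + b * c"
    by transfer (auto simp: fun_eq_iff mod_simps distrib_right)
  show "(0 :: 'a ladic_int) \<noteq> 1"
  proof transfer
    have "(1::int) mod int CARD('a) ^ 1 = 1"
      using prime_gt_1_int[OF prime_card_int[where 'a='a]] by simp
    thus "(\<lambda>_. 0) \<noteq> (\<lambda>n. 1 mod int CARD('a) ^ n)"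
      by (metis zero_neq_one)
  qed
qed

end

lemma ladic_residue_mod:
  fixes a :: "'l::prime_card ladic_int"
  assumes "m \<le> n"
  shows "ladic_residue a n mod int CARD('l) ^ m = ladic_residue a m"
  using assms
proof (induction n rule: dec_induct)
  case base
  then show ?case using ladic_residue[of a] by simp
next
  case (step n)
  have "ladic_residue a (Suc n) mod int CARD('l) ^ m
      = (ladic_residue a (Suc n) mod int CARD('l) ^ n) mod int CARD('l) ^ m"
    using step by (simp add: mod_mod_cancel le_imp_power_dvd)
  also have "\<dots> = ladic_residue a m"
    using ladic_residue[of a] step by simp
  finally show ?case .
qed

instance ladic_int :: (prime_card) idom
proof
  fix a b :: "'a ladic_int"
  let ?q = "int CARD('a)"
  assume "a \<noteq> 0" "b \<noteq> 0"
  then obtain m k where m: "ladic_residue a m \<noteq> 0" and k: "ladic_residue b k \<noteq> 0"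
    by (metis ladic_residue_inject zero_ladic_int.rep_eq ext)
  have a: "\<not> ?q ^ m dvd ladic_residue a (m + k)"
    using m ladic_residue_mod[of m "m + k" a] by (simp add: dvd_eq_mod_eq_0)
  have b: "\<not> ?q ^ k dvd ladic_residue b (m + k)"
    using k ladic_residue_mod[of k "m + k" b] by (simp add: dvd_eq_mod_eq_0)
  have nz: "ladic_residue a (m + k) \<noteq> 0" "ladic_residue b (m + k) \<noteq> 0"
    using a b by (metis dvd_0_right)+
  have nu: "\<not> is_unit ?q" and pe: "prime_elem ?q"
    using prime_card_int[where 'a='a] not_prime_unit prime_imp_prime_elem by blast+
  have "multiplicity ?q (ladic_residue a (m + k) * ladic_residue b (m + k)) < m + k"
    using a b nz nu pe
    by (simp add: prime_elem_multiplicity_mult_distrib power_dvd_iff_le_multiplicity)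
  hence "\<not> ?q ^ (m + k) dvd ladic_residue a (m + k) * ladic_residue b (m + k)"
    using nz nu by (simp add: power_dvd_iff_le_multiplicity)
  hence "ladic_residue (a * b) (m + k) \<noteq> 0"
    by (simp add: times_ladic_int.rep_eq dvd_eq_mod_eq_0)
  thus "a * b \<noteq> 0"
    by (metis zero_ladic_int.rep_eq)
qed

type_synonym 'l ladic_rat = "'l ladic_int fract"
type_synonym 'l ladic_closure = "'l ladic_rat alg_closure"

section \<open>Extension of scalars\<close>

text \<open>\<open>base_change h M\<close> is the tensor product of the \<open>R\<close>-module \<open>M\<close> with \<open>S\<close> along the ring
  homomorphism \<open>h\<close> from \<open>R\<close> to \<open>S\<close>: the free \<open>S\<close>-module on the set \<open>M\<close>, where \<open>single m s\<close>
  stands for the tensor of \<open>m\<close> and \<open>s\<close>, modulo the submodule generated by the tensor relations.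
  Here \<open>R\<close> and \<open>S\<close> are types. The multiplication and the unit of a module record are irrelevant.\<close>

inductive_set tensor_relations ::
    "('r \<Rightarrow> 's::comm_ring_1) \<Rightarrow> ('r, 'm, 'z) module_scheme \<Rightarrow> ('m \<Rightarrow>\<^sub>0 's) set"
  for h M where
  zero: "0 \<in> tensor_relations h M"
| add: "\<lbrakk>\<phi> \<in> tensor_relations h M; m \<in> carrier M; m' \<in> carrier M\<rbrakk> \<Longrightarrow>
    \<phi> + (Poly_Mapping.single (m \<oplus>\<^bsub>M\<^esub> m') s - Poly_Mapping.single m s - Poly_Mapping.single m' s)
      \<in> tensor_relations h M"
| scale: "\<lbrakk>\<phi> \<in> tensor_relations h M; m \<in> carrier M\<rbrakk> \<Longrightarrow>
    \<phi> + (Poly_Mapping.single (a \<odot>\<^bsub>M\<^esub> m) s - Poly_Mapping.single m (h a * s))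
      \<in> tensor_relations h M"

definition tensor_class ::
    "('r \<Rightarrow> 's::comm_ring_1) \<Rightarrow> ('r, 'm, 'z) module_scheme \<Rightarrow> ('m \<Rightarrow>\<^sub>0 's) \<Rightarrow> ('m \<Rightarrow>\<^sub>0 's) set" where
  "tensor_class h M \<phi> =
     {\<psi>. Poly_Mapping.keys \<psi> \<subseteq> carrier M \<and> \<psi> - \<phi> \<in> tensor_relations h M}"

definition base_change ::
    "('r \<Rightarrow> 's::comm_ring_1) \<Rightarrow> ('r, 'm, 'z) module_scheme \<Rightarrow> ('s, ('m \<Rightarrow>\<^sub>0 's) set) module" where
  "base_change h M =
     \<lparr>carrier = tensor_class h M ` {\<phi>. Poly_Mapping.keys \<phi> \<subseteq> carrier M},
      monoid.mult = undefined, monoid.one = undefined,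
      ring.zero = tensor_class h M 0,
      ring.add = (\<lambda>A B. \<Union>\<phi>\<in>A. \<Union>\<psi>\<in>B. tensor_class h M (\<phi> + \<psi>)),
      module.smult = (\<lambda>s A. \<Union>\<phi>\<in>A. tensor_class h M (Poly_Mapping.map ((*) s) \<phi>))\<rparr>"

definition base_change_map ::
    "('r \<Rightarrow> 's::comm_ring_1) \<Rightarrow> ('r, 'm, 'z) module_scheme \<Rightarrow> ('m \<Rightarrow> 'm)
      \<Rightarrow> ('m \<Rightarrow>\<^sub>0 's) set \<Rightarrow> ('m \<Rightarrow>\<^sub>0 's) set" where
  "base_change_map h M T A =
     (\<Union>\<phi>\<in>A. tensor_class h M
        (\<Sum>m\<in>Poly_Mapping.keys \<phi>. Poly_Mapping.single (T m) (Poly_Mapping.lookup \<phi> m)))"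

section \<open>Smooth projective curves and their Jacobians\<close>

text \<open>A smooth projective curve over an algebraically closed field \<open>k\<close> is given by its function
  field \<open>F\<close>, a ring record with subfield of constants \<open>k\<close>. Its points are the normalised discrete
  valuations of \<open>F\<close> that are trivial on \<open>k\<close>, and \<open>pic0 F k\<close>, written multiplicatively as quotient
  groups in the library are, is the group of \<open>k\<close>-points of its Jacobian.\<close>

type_synonym 'a divisor = "('a \<Rightarrow> int) \<Rightarrow>\<^sub>0 int"

definition places :: "('a, 'm) ring_scheme \<Rightarrow> 'a set \<Rightarrow> ('a \<Rightarrow> int) set" where
  "places F k =
     {v \<in> extensional (carrier F - {\<zero>\<^bsub>F\<^esub>}).
        discrete_valuation F v \<and> (\<forall>a \<in> k - {\<zero>\<^bsub>F\<^esub>}. v a = 0)}"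

definition divisor_degree :: "'a divisor \<Rightarrow> int" where
  "divisor_degree D = (\<Sum>v\<in>Poly_Mapping.keys D. Poly_Mapping.lookup D v)"

definition principal_divisors :: "('a, 'm) ring_scheme \<Rightarrow> 'a set \<Rightarrow> 'a divisor set" where
  "principal_divisors F k =
     {D \<in> carrier (free_Abelian_group (places F k)).
        \<exists>g \<in> carrier F - {\<zero>\<^bsub>F\<^esub>}. \<forall>v \<in> places F k. Poly_Mapping.lookup D v = v g}"

definition pic0 :: "('a, 'm) ring_scheme \<Rightarrow> 'a set \<Rightarrow> 'a divisor set monoid" where
  "pic0 F k =
     (free_Abelian_group (places F k))
       \<lparr>carrier := {D \<in> carrier (free_Abelian_group (places F k)). divisor_degree D = 0}\<rparr>
     Mod principal_divisors F k"

text \<open>A ring automorphism \<open>\<alpha>\<close> of \<open>F\<close> preserving the constants acts on places in such a way that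
  the divisor of \<open>\<alpha> g\<close> is the image of the divisor of \<open>g\<close>. If \<open>\<alpha>\<close> is composition with an
  automorphism \<open>t\<close> of the curve, then this is the pullback \<open>t\<^sup>*\<close> on divisors (a point goes to its
  preimage under \<open>t\<close>). If \<open>\<alpha>\<close> comes from an automorphism \<open>\<sigma>\<close> of \<open>k\<close> and a model of the curve over
  the fixed field of \<open>\<sigma>\<close>, then this is the left action of \<open>\<sigma>\<close> on points.\<close>

definition place_map :: "('a, 'm) ring_scheme \<Rightarrow> ('a \<Rightarrow> 'a) \<Rightarrow> ('a \<Rightarrow> int) \<Rightarrow> 'a \<Rightarrow> int" where
  "place_map F \<alpha> v = restrict (\<lambda>g. v (inv_into (carrier F) \<alpha> g)) (carrier F - {\<zero>\<^bsub>F\<^esub>})"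

definition pic0_map ::
    "('a, 'm) ring_scheme \<Rightarrow> ('a \<Rightarrow> 'a) \<Rightarrow> 'a divisor set \<Rightarrow> 'a divisor set" where
  "pic0_map F \<alpha> Y = frag_extend (\<lambda>v. frag_of (place_map F \<alpha> v)) ` Y"

section \<open>Tate modules\<close>

text \<open>The inverse limit of the \<open>\<ell>\<^sup>n\<close>-torsion of the (multiplicatively written) group \<open>J\<close>.\<close>

definition tate_module ::
    "('g, 'm) monoid_scheme \<Rightarrow> ('l::prime_card ladic_int, nat \<Rightarrow> 'g) module" where
  "tate_module J =
     \<lparr>carrier = {x. \<forall>n. x n \<in> carrier J \<and> x n [^]\<^bsub>J\<^esub> (CARD('l) ^ n) = \<one>\<^bsub>J\<^esub> \<and>
                       x (Suc n) [^]\<^bsub>J\<^esub> CARD('l) = x n},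
      monoid.mult = undefined, monoid.one = undefined,
      ring.zero = (\<lambda>_. \<one>\<^bsub>J\<^esub>),
      ring.add = (\<lambda>x y n. x n \<otimes>\<^bsub>J\<^esub> y n),
      module.smult = (\<lambda>a x n. x n [^]\<^bsub>J\<^esub> ladic_residue a n)\<rparr>"

definition rational_tate_module ::
    "('g, 'm) monoid_scheme \<Rightarrow>
      ('l::prime_card ladic_rat, ((nat \<Rightarrow> 'g) \<Rightarrow>\<^sub>0 'l ladic_rat) set) module" where
  "rational_tate_module J = base_change to_fract (tate_module J)"

definition rational_tate_map ::
    "('g, 'm) monoid_scheme \<Rightarrow> ('g \<Rightarrow> 'g) \<Rightarrow>
      ((nat \<Rightarrow> 'g) \<Rightarrow>\<^sub>0 'l::prime_card ladic_rat) set \<Rightarrow> ((nat \<Rightarrow> 'g) \<Rightarrow>\<^sub>0 'l ladic_rat) set" where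
  "rational_tate_map J T = base_change_map to_fract (tate_module J) (\<lambda>x n. T (x n))"

section \<open>Superelliptic curves\<close>

text \<open>Elements of the function field of the curve \<open>y\<^sup>n = f(x)\<close> over the algebraic closure of \<open>K\<close> are
  represented by their unique representatives of degree less than \<open>n\<close> in \<open>y\<close>.\<close>

type_synonym 'k curve_fun = "'k alg_closure poly fract poly"

definition curve_equation :: "nat \<Rightarrow> 'k::field poly \<Rightarrow> 'k curve_fun" where
  "curve_equation n f = monom 1 n - [:to_fract (map_poly to_ac f):]"

definition function_field :: "nat \<Rightarrow> 'k::field poly \<Rightarrow> 'k curve_fun ring" where
  "function_field n f =
     \<lparr>carrier = {g. degree g < n},
      monoid.mult = (\<lambda>g h. (g * h) mod curve_equation n f),
      monoid.one = 1, ring.zero = 0, ring.add = (+)\<rparr>"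

definition curve_constants :: "'k::field curve_fun set" where
  "curve_constants = range (\<lambda>a. [:to_fract [:a:]:])"

definition jacobian :: "nat \<Rightarrow> 'k::field poly \<Rightarrow> 'k curve_fun divisor set monoid" where
  "jacobian n f = pic0 (function_field n f) curve_constants"

text \<open>The function \<open>g(x, z y)\<close>, i.e. \<open>g\<close> composed with the automorphism \<open>(x, y) \<mapsto> (x, z y)\<close> of the
  curve, for \<open>z \<in> K\<close> with \<open>z\<^sup>n = 1\<close>.\<close>

definition mu_action :: "'k::field \<Rightarrow> 'k curve_fun \<Rightarrow> 'k curve_fun" where
  "mu_action z g = pcompose g [:0, to_fract [:to_ac z:]:]"

definition map_fract :: "('a::idom \<Rightarrow> 'b::idom) \<Rightarrow> 'a fract \<Rightarrow> 'b fract" where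
  "map_fract h q =
     (THE w. \<exists>a b. b \<noteq> 0 \<and> q = Fraction_Field.Fract a b \<and> w = Fraction_Field.Fract (h a) (h b))"

definition galois_action ::
    "('k::field alg_closure \<Rightarrow> 'k alg_closure) \<Rightarrow> 'k curve_fun \<Rightarrow> 'k curve_fun" where
  "galois_action \<sigma> = map_poly (map_fract (map_poly \<sigma>))"

definition jacobian_tate_map ::
    "nat \<Rightarrow> 'k::field poly \<Rightarrow> ('k curve_fun \<Rightarrow> 'k curve_fun) \<Rightarrow>
      ((nat \<Rightarrow> 'k curve_fun divisor set) \<Rightarrow>\<^sub>0 'l::prime_card ladic_rat) set \<Rightarrow>
      ((nat \<Rightarrow> 'k curve_fun divisor set) \<Rightarrow>\<^sub>0 'l ladic_rat) set" where
  "jacobian_tate_map n f \<alpha> =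
     rational_tate_map (jacobian n f) (pic0_map (function_field n f) \<alpha>)"

section \<open>New parts and eigenspaces\<close>

text \<open>\<open>X\<^sup>d - 1\<close> is the product of \<open>cyclotomic e\<close> over the divisors \<open>e\<close> of \<open>d\<close>.\<close>

declare prod.cong [fundef_cong]

function cyclotomic :: "nat \<Rightarrow> int poly" where
  "cyclotomic d = (monom 1 d - 1) div (\<Prod>e \<in> {e. e dvd d \<and> e < d}. cyclotomic e)"
  by pat_completeness auto
termination
  by (relation "measure id") auto

declare cyclotomic.simps [simp del]

text \<open>\<open>P(T) v\<close>, by Horner's rule, for an integer polynomial \<open>P\<close>.\<close>

definition poly_apply ::
    "('s::comm_ring_1, 'v, 'z) module_scheme \<Rightarrow> int poly \<Rightarrow> ('v \<Rightarrow> 'v) \<Rightarrow> 'v \<Rightarrow> 'v" where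
  "poly_apply V P T v =
     fold_coeffs (\<lambda>a w. (of_int a \<odot>\<^bsub>V\<^esub> v) \<oplus>\<^bsub>V\<^esub> T w) P \<zero>\<^bsub>V\<^esub>"

text \<open>The \<open>d\<close>-new part for the curve \<open>y\<^sup>d = f(x)\<close>; \<open>z\<close> is the root of unity in \<open>K\<close> by which the
  generator \<open>t\<close> acts on the coordinate \<open>y\<close>.\<close>

definition new_part ::
    "nat \<Rightarrow> 'k::field poly \<Rightarrow> 'k \<Rightarrow>
      ('l::prime_card ladic_rat,
       ((nat \<Rightarrow> 'k curve_fun divisor set) \<Rightarrow>\<^sub>0 'l ladic_rat) set) module" where
  "new_part d f z =
     (let V = rational_tate_module (jacobian d f) in
      V\<lparr>carrier := {v \<in> carrier V.
          poly_apply V (cyclotomic d) (jacobian_tate_map d f (mu_action z)) v = \<zero>\<^bsub>V\<^esub>}\<rparr>)"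

type_synonym ('k, 'l) tate_vector =
  "((((nat \<Rightarrow> 'k curve_fun divisor set) \<Rightarrow>\<^sub>0 'l ladic_rat) set) \<Rightarrow>\<^sub>0 'l ladic_closure) set"

definition new_part_ext ::
    "nat \<Rightarrow> 'k::field poly \<Rightarrow> 'k \<Rightarrow> ('l::prime_card ladic_closure, ('k, 'l) tate_vector) module" where
  "new_part_ext d f z = base_change to_ac (new_part d f z)"

definition new_part_ext_map ::
    "nat \<Rightarrow> 'k::field poly \<Rightarrow> 'k \<Rightarrow> ('k curve_fun \<Rightarrow> 'k curve_fun) \<Rightarrow>
      ('k, 'l::prime_card) tate_vector \<Rightarrow> ('k, 'l) tate_vector" where
  "new_part_ext_map d f z \<alpha> = base_change_map to_ac (new_part d f z) (jacobian_tate_map d f \<alpha>)"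

type_synonym ('g, 's, 'v) rep = "('s, 'v) module \<times> ('g \<Rightarrow> 'v \<Rightarrow> 'v)"

text \<open>The subspace of the \<open>d\<close>-new part (with scalars extended) on which \<open>t\<close> acts as the scalar \<open>e\<close>,
  with its action of the absolute Galois group of \<open>K\<close>.\<close>

definition new_eigen_rep ::
    "nat \<Rightarrow> 'k::field poly \<Rightarrow> 'k \<Rightarrow> 'l::prime_card ladic_closure \<Rightarrow>
      ('k alg_closure \<Rightarrow> 'k alg_closure, 'l ladic_closure, ('k, 'l) tate_vector) rep" where
  "new_eigen_rep d f z e =
     (let V = new_part_ext d f z in
      (V\<lparr>carrier := {v \<in> carrier V. new_part_ext_map d f z (mu_action z) v = e \<odot>\<^bsub>V\<^esub> v}\<rparr>,
       \<lambda>\<sigma>. new_part_ext_map d f z (galois_action \<sigma>)))"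

text \<open>The tensor product with a character \<open>\<psi>\<close>, on the same underlying space. Suppose that
  \<open>\<gamma>\<^sup>n = c\<close> and that an automorphism multiplies \<open>\<gamma>\<close> by a root of unity whose image on the
  \<open>\<ell>\<close>-adic side is \<open>w\<close>. For \<open>d dvd n\<close> the isomorphism from \<open>y\<^sup>d = f(x)\<close> to \<open>y\<^sup>d = c f(x)\<close>
  scales \<open>y\<close> by the \<open>d\<close>-th root \<open>\<gamma> ^ (n div d)\<close> of \<open>c\<close>, which that automorphism multiplies by the
  root of unity corresponding to \<open>w ^ (n div d)\<close>. So the character by which these curves differ is
  the power \<open>n div d\<close> of the one attached to \<open>\<gamma>\<close>; for \<open>d = n\<close> it is that character itself.\<close>

definition twist :: "('g, 's, 'v) rep \<Rightarrow> ('g \<Rightarrow> 's) \<Rightarrow> ('g, 's, 'v) rep" where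
  "twist R \<psi> = (fst R, \<lambda>\<sigma> v. \<psi> \<sigma> \<odot>\<^bsub>fst R\<^esub> snd R \<sigma> v)"

definition rep_iso :: "('g, 'm) monoid_scheme \<Rightarrow> ('g, 's, 'v) rep \<Rightarrow> ('g, 's, 'w) rep \<Rightarrow> bool" where
  "rep_iso G R S \<longleftrightarrow>
     (\<exists>\<phi>. bij_betw \<phi> (carrier (fst R)) (carrier (fst S)) \<and>
        (\<forall>v \<in> carrier (fst R). \<forall>w \<in> carrier (fst R).
            \<phi> (v \<oplus>\<^bsub>fst R\<^esub> w) = \<phi> v \<oplus>\<^bsub>fst S\<^esub> \<phi> w) \<and>
        (\<forall>a. \<forall>v \<in> carrier (fst R). \<phi> (a \<odot>\<^bsub>fst R\<^esub> v) = a \<odot>\<^bsub>fst S\<^esub> \<phi> v) \<and>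
        (\<forall>\<sigma> \<in> carrier G. \<forall>v \<in> carrier (fst R). \<phi> (snd R \<sigma> v) = snd S \<sigma> (\<phi> v)))"

end

theory Submission imports Defs begin

text \<open>Let \<open>\<delta>\<close> be a \<open>d\<close>-th root of \<open>c\<close>. Over the algebraic closure the substitution \<open>y \<mapsto> \<delta>\<^sup>-\<^sup>1 y\<close> is an
  isomorphism \<open>\<Phi>\<close> from the function field of \<open>y\<^sup>d = f(x)\<close> to that of \<open>y\<^sup>d = c f(x)\<close>. It commutes with
  \<open>t\<close>, but not with Galois: if \<open>\<sigma> \<delta> = \<zeta>\<^sub>d\<^sup>j \<delta>\<close>, then \<open>\<Phi> \<circ> \<sigma> = t\<^sup>j \<circ> \<sigma> \<circ> \<Phi>\<close>. Everything from the function
  field to the eigenspace of the Tate module is functorial for isomorphisms of this kind, and on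
  the eigenspace \<open>t\<^sup>j\<close> is multiplication by \<open>\<zeta>\<^sub>d\<^sup>i\<^sup>j\<close>, which is the value at \<open>\<sigma>\<close> of the twisting
  character.\<close>

section \<open>Functoriality of the extension of scalars\<close>

text \<open>The two sides of the claim speak about roots of unity in different fields:
  \<open>\<zeta>\<close> lies in K and describes how Galois moves \<open>\<gamma>\<close>, while
  \<open>\<zeta>l\<close> lies in the l-adic closure and gives the eigenvalues and the values of
  \<open>\<chi>\<close>. Only exponents link them. So it is not enough to know that an automorphism
  multiplies \<open>\<gamma>\<close> by some power of \<open>\<zeta>\<close> and that
  \<open>\<chi>\<close> takes some power of \<open>\<zeta>l\<close> as its value: one and the same
  exponent has to describe both. Since \<open>\<chi>\<close> is prescribed at the generator alone,
  this joint statement is proved along words in the generator.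

  The objects in between are quotients with explicit representatives: tensor classes of formal sums
  and cosets of divisors. Induced maps act on representatives, so functoriality reduces to
  identities between formal sums. What remains of the Galois compatibility is one identity between
  composites of maps of function fields.

  For general \<open>d\<close> the root is \<open>\<delta> = \<gamma> ^ (n div d)\<close> and the
  eigenvalue is the power \<open>i\<close> of \<open>\<zeta>l ^ (n div d)\<close>, which is why the
  character enters with both exponents.\<close>

definition free_map :: "('m \<Rightarrow> 'n) \<Rightarrow> ('m \<Rightarrow>\<^sub>0 's::comm_ring_1) \<Rightarrow> ('n \<Rightarrow>\<^sub>0 's)" where
  "free_map T \<phi> = (\<Sum>m\<in>Poly_Mapping.keys \<phi>. Poly_Mapping.single (T m) (Poly_Mapping.lookup \<phi> m))"

text \<open>Additional indices contribute only zero terms. Addition and scaling can cancel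
  coefficients and so shrink the support; sums over a common larger index set avoid following
  this.\<close>

lemma free_map_superset:
  assumes "finite A" "Poly_Mapping.keys \<phi> \<subseteq> A"
  shows "free_map T \<phi> = (\<Sum>m\<in>A. Poly_Mapping.single (T m) (Poly_Mapping.lookup \<phi> m))"
  unfolding free_map_def
  by (rule sum.mono_neutral_left) (use assms in \<open>auto simp: in_keys_iff\<close>)

lemma free_map_zero [simp]: "free_map T 0 = 0"
  by (simp add: free_map_def)

lemma free_map_single [simp]: "free_map T (Poly_Mapping.single m s) = Poly_Mapping.single (T m) s"
  by (simp add: free_map_def)

lemma free_map_add: "free_map T (\<phi> + \<psi>) = free_map T \<phi> + free_map T \<psi>"
proof -
  let ?A = "Poly_Mapping.keys \<phi> \<union> Poly_Mapping.keys \<psi>"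
  have "Poly_Mapping.keys (\<phi> + \<psi>) \<subseteq> ?A" by (rule Poly_Mapping.keys_add)
  then show ?thesis
    by (simp add: free_map_superset[of ?A] lookup_add single_add sum.distrib)
qed

lemma free_map_uminus: "free_map T (- \<phi>) = - free_map T \<phi>"
  using free_map_add[of T \<phi> "- \<phi>"] by (simp add: add_eq_0_iff)

lemma free_map_diff: "free_map T (\<phi> - \<psi>) = free_map T \<phi> - free_map T \<psi>"
  using free_map_add[of T \<phi> "- \<psi>"] by (simp add: free_map_uminus)

lemma free_map_sum: "free_map T (sum g A) = (\<Sum>x\<in>A. free_map T (g x))"
  by (induction A rule: infinite_finite_induct) (auto simp: free_map_add)

lemma free_map_free_map: "free_map T (free_map S \<phi>) = free_map (T \<circ> S) \<phi>"
  by (simp add: free_map_def[of S] free_map_def[of "T \<circ> S"] free_map_sum)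

lemma free_map_cong:
  "(\<And>m. m \<in> Poly_Mapping.keys \<phi> \<Longrightarrow> T m = S m) \<Longrightarrow> free_map T \<phi> = free_map S \<phi>"
  by (simp add: free_map_def)

lemma free_map_id: "free_map (\<lambda>m. m) \<phi> = \<phi>"
  by (rule poly_mapping_eqI)
     (simp add: free_map_def lookup_sum lookup_single when_def in_keys_iff)

lemma keys_free_map: "Poly_Mapping.keys (free_map T \<phi>) \<subseteq> T ` Poly_Mapping.keys \<phi>"
  unfolding free_map_def by (rule order_trans[OF keys_sum]) auto

section \<open>Scaling of formal sums and the submodule of tensor relations\<close>

definition free_scale :: "'s::comm_ring_1 \<Rightarrow> ('m \<Rightarrow>\<^sub>0 's) \<Rightarrow> ('m \<Rightarrow>\<^sub>0 's)" where
  "free_scale s = Poly_Mapping.map ((*) s)"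

lemma lookup_free_scale [simp]:
  "Poly_Mapping.lookup (free_scale s \<phi>) m = s * Poly_Mapping.lookup \<phi> m"
  by (simp add: free_scale_def Poly_Mapping.map.rep_eq when_def)

lemma free_scale_simps [simp]:
  "free_scale s 0 = 0"
  "free_scale s (Poly_Mapping.single m t) = Poly_Mapping.single m (s * t)"
  "free_scale s (\<phi> + \<psi>) = free_scale s \<phi> + free_scale s \<psi>"
  "free_scale s (\<phi> - \<psi>) = free_scale s \<phi> - free_scale s \<psi>"
  "free_scale s (free_scale t \<phi>) = free_scale (s * t) \<phi>"
  "free_scale 1 \<phi> = \<phi>"
  by (auto intro!: poly_mapping_eqI simp: lookup_single when_def lookup_add lookup_minus algebra_simps)

lemma keys_free_scale: "Poly_Mapping.keys (free_scale s \<phi>) \<subseteq> Poly_Mapping.keys \<phi>"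
  by (auto simp: in_keys_iff)

lemma free_map_scale:
  fixes T :: "'m \<Rightarrow> 'n" and s :: "'s::comm_ring_1"
  shows "free_map T (free_scale s \<phi>) = free_scale s (free_map T \<phi>)"
proof -
  have sum: "free_scale s (sum g A) = (\<Sum>x\<in>A. free_scale s (g x))"
    for g :: "'m \<Rightarrow> 'n \<Rightarrow>\<^sub>0 's" and A
    by (induction A rule: infinite_finite_induct) auto
  show ?thesis
    by (simp add: free_map_superset[OF finite_keys keys_free_scale] sum free_map_def[of T \<phi>])
qed

text \<open>The inductive set adds one generator at a time, so closure under sums is an induction on
  one summand, as for concatenation of lists.\<close>

lemma tensor_relations_add:
  assumes "\<psi> \<in> tensor_relations h M" "\<phi> \<in> tensor_relations h M"
  shows "\<phi> + \<psi> \<in> tensor_relations h M"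
  using assms
  by (induction rule: tensor_relations.induct)
     (auto simp: add.assoc[symmetric] intro: tensor_relations.intros)

text \<open>Each generator carries an arbitrary coefficient, so a multiple of a generator is a
  generator of the same shape; for scalar relations this uses commutativity of the coefficients.
  Negation is then the case of the scalar -1.\<close>

lemma tensor_relations_scale:
  assumes "\<phi> \<in> tensor_relations h M"
  shows "free_scale s \<phi> \<in> tensor_relations h M"
  using assms
proof (induction rule: tensor_relations.induct)
  case zero
  then show ?case by (simp add: tensor_relations.zero)
next
  case (add \<phi> m m' t)
  then show ?case by (simp add: tensor_relations.add)
next
  case (scale \<phi> m a t)
  then show ?case
    using tensor_relations.scale[OF scale.IH, of m a "s * t"] by (simp add: mult.left_commute)
qed

lemma tensor_relations_uminus:
  assumes "\<phi> \<in> tensor_relations h M"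
  shows "- \<phi> \<in> tensor_relations h M"
proof -
  have "- \<phi> = free_scale (-1) \<phi>" by (rule poly_mapping_eqI) simp
  then show ?thesis using tensor_relations_scale[OF assms] by simp
qed

lemma tensor_relations_diff:
  "\<phi> \<in> tensor_relations h M \<Longrightarrow> \<psi> \<in> tensor_relations h M \<Longrightarrow> \<phi> - \<psi> \<in> tensor_relations h M"
  using tensor_relations_add[OF tensor_relations_uminus] by fastforce

text \<open>No module axioms are required of \<open>M\<close> and \<open>M'\<close>, and the carriers need not be closed under the
  operations.\<close>

definition module_map ::
    "('r, 'm, 'y) module_scheme \<Rightarrow> ('r, 'n, 'z) module_scheme \<Rightarrow> ('m \<Rightarrow> 'n) \<Rightarrow> bool" where
  "module_map M M' T \<longleftrightarrow>
     T \<in> carrier M \<rightarrow> carrier M' \<and>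
     (\<forall>x\<in>carrier M. \<forall>y\<in>carrier M. T (x \<oplus>\<^bsub>M\<^esub> y) = T x \<oplus>\<^bsub>M'\<^esub> T y) \<and>
     (\<forall>a. \<forall>x\<in>carrier M. T (a \<odot>\<^bsub>M\<^esub> x) = a \<odot>\<^bsub>M'\<^esub> T x)"

lemma module_mapD:
  assumes "module_map M M' T"
  shows "x \<in> carrier M \<Longrightarrow> T x \<in> carrier M'"
    "x \<in> carrier M \<Longrightarrow> y \<in> carrier M \<Longrightarrow> T (x \<oplus>\<^bsub>M\<^esub> y) = T x \<oplus>\<^bsub>M'\<^esub> T y"
    "x \<in> carrier M \<Longrightarrow> T (a \<odot>\<^bsub>M\<^esub> x) = a \<odot>\<^bsub>M'\<^esub> T x"
  using assms by (auto simp: module_map_def)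

lemma module_map_comp:
  "module_map M M' S \<Longrightarrow> module_map M' M'' T \<Longrightarrow> module_map M M'' (T \<circ> S)"
  unfolding module_map_def by (auto simp: Pi_iff)

lemma tensor_relations_map:
  assumes "module_map M M' T" "\<phi> \<in> tensor_relations h M"
  shows "free_map T \<phi> \<in> tensor_relations h M'"
  using assms(2)
  by (induction rule: tensor_relations.induct)
     (auto simp: free_map_add free_map_diff module_mapD[OF assms(1)] intro: tensor_relations.intros)

section \<open>Operations of the tensor product computed on representatives\<close>

abbreviation supported :: "('m, 'z) partial_object_scheme \<Rightarrow> ('m \<Rightarrow>\<^sub>0 's::zero) \<Rightarrow> bool" where
  "supported M \<phi> \<equiv> Poly_Mapping.keys \<phi> \<subseteq> carrier M"

lemma supported_add: "supported M \<phi> \<Longrightarrow> supported M \<psi> \<Longrightarrow> supported M (\<phi> + \<psi>)"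
  using Poly_Mapping.keys_add[of \<phi> \<psi>] by blast

lemma supported_scale: "supported M \<phi> \<Longrightarrow> supported M (free_scale s \<phi>)"
  using keys_free_scale[of s \<phi>] by blast

lemma supported_map: "module_map M M' T \<Longrightarrow> supported M \<phi> \<Longrightarrow> supported M' (free_map T \<phi>)"
  using keys_free_map[of T \<phi>] by (fastforce simp: module_map_def)

lemma tensor_class_eq:
  assumes "\<phi> - \<psi> \<in> tensor_relations h M"
  shows "tensor_class h M \<phi> = tensor_class h M \<psi>"
proof -
  have "\<theta> - \<phi> \<in> tensor_relations h M \<longleftrightarrow> \<theta> - \<psi> \<in> tensor_relations h M" for \<theta>
    using tensor_relations_add[of "\<phi> - \<psi>" h M "\<theta> - \<phi>"]
      tensor_relations_diff[of "\<theta> - \<psi>" h M "\<phi> - \<psi>"] assms by auto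
  then show ?thesis by (simp add: tensor_class_def)
qed

lemma tensor_class_self: "supported M \<phi> \<Longrightarrow> \<phi> \<in> tensor_class h M \<phi>"
  by (simp add: tensor_class_def tensor_relations.zero)

lemma carrier_base_change: "carrier (base_change h M) = tensor_class h M ` {\<phi>. supported M \<phi>}"
  by (simp add: base_change_def)

lemma tensor_class_in_carrier: "supported M \<phi> \<Longrightarrow> tensor_class h M \<phi> \<in> carrier (base_change h M)"
  by (simp add: carrier_base_change)

lemma base_change_cases:
  assumes "A \<in> carrier (base_change h M)"
  obtains \<phi> where "supported M \<phi>" "A = tensor_class h M \<phi>"
  using assms by (auto simp: carrier_base_change)

lemma base_change_zero: "\<zero>\<^bsub>base_change h M\<^esub> = tensor_class h M 0"
  by (simp add: base_change_def)

text \<open>The operations of \<open>base_change\<close> are unions over all representatives of a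
  class. Such a union is a single class as soon as the family is constant and the index set is
  inhabited, so evaluating an operation amounts to independence of representatives.\<close>

lemma UN_eq_const: "a \<in> A \<Longrightarrow> (\<And>x. x \<in> A \<Longrightarrow> F x = c) \<Longrightarrow> (\<Union>x\<in>A. F x) = c"
  by blast

lemma base_change_add:
  assumes "supported M \<phi>" "supported M \<psi>"
  shows "tensor_class h M \<phi> \<oplus>\<^bsub>base_change h M\<^esub> tensor_class h M \<psi> = tensor_class h M (\<phi> + \<psi>)"
proof -
  have "tensor_class h M (\<phi>' + \<psi>') = tensor_class h M (\<phi> + \<psi>)"
    if "\<phi>' \<in> tensor_class h M \<phi>" "\<psi>' \<in> tensor_class h M \<psi>" for \<phi>' \<psi>'
  proof (rule tensor_class_eq)
    show "\<phi>' + \<psi>' - (\<phi> + \<psi>) \<in> tensor_relations h M"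
      using that tensor_relations_add[of "\<phi>' - \<phi>" h M "\<psi>' - \<psi>"]
      by (simp add: tensor_class_def algebra_simps)
  qed
  then show ?thesis
    unfolding base_change_def ring.simps
    by (intro UN_eq_const[OF tensor_class_self[OF assms(1)]] UN_eq_const[OF tensor_class_self[OF assms(2)]])
qed

lemma base_change_smult:
  assumes "supported M \<phi>"
  shows "s \<odot>\<^bsub>base_change h M\<^esub> tensor_class h M \<phi> = tensor_class h M (free_scale s \<phi>)"
proof -
  have "tensor_class h M (free_scale s \<phi>') = tensor_class h M (free_scale s \<phi>)"
    if "\<phi>' \<in> tensor_class h M \<phi>" for \<phi>'
    using that tensor_relations_scale[of "\<phi>' - \<phi>" h M s]
    by (intro tensor_class_eq) (simp add: tensor_class_def)
  then show ?thesis
    unfolding base_change_def module.simps free_scale_def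
    by (intro UN_eq_const[OF tensor_class_self[OF assms]])
qed

text \<open>\<open>base_change_map\<close> mentions the target module only. The source enters
  through the relations that \<open>T\<close> has to carry into those of the target, which makes the
  image class independent of the representative.\<close>

lemma base_change_map_class:
  assumes "module_map M M' T" "supported M \<phi>"
  shows "base_change_map h M' T (tensor_class h M \<phi>) = tensor_class h M' (free_map T \<phi>)"
proof -
  have "tensor_class h M' (free_map T \<phi>') = tensor_class h M' (free_map T \<phi>)"
    if "\<phi>' \<in> tensor_class h M \<phi>" for \<phi>'
    using that tensor_relations_map[OF assms(1), of "\<phi>' - \<phi>" h]
    by (intro tensor_class_eq) (simp add: tensor_class_def free_map_diff)
  then show ?thesis
    unfolding base_change_map_def free_map_def
    by (intro UN_eq_const[OF tensor_class_self[OF assms(2)]])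
qed

lemma base_change_closed:
  "x \<in> carrier (base_change h M) \<Longrightarrow> y \<in> carrier (base_change h M) \<Longrightarrow>
     x \<oplus>\<^bsub>base_change h M\<^esub> y \<in> carrier (base_change h M)"
  "x \<in> carrier (base_change h M) \<Longrightarrow> s \<odot>\<^bsub>base_change h M\<^esub> x \<in> carrier (base_change h M)"
  "\<zero>\<^bsub>base_change h M\<^esub> \<in> carrier (base_change h M)"
  by (auto elim!: base_change_cases simp: base_change_zero base_change_add base_change_smult
      supported_add supported_scale tensor_class_in_carrier)

lemma base_change_smult_one:
  "x \<in> carrier (base_change h M) \<Longrightarrow> 1 \<odot>\<^bsub>base_change h M\<^esub> x = x"
  by (erule base_change_cases) (simp add: base_change_smult)

lemma base_change_smult_smult:
  "x \<in> carrier (base_change h M) \<Longrightarrow>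
     a \<odot>\<^bsub>base_change h M\<^esub> (b \<odot>\<^bsub>base_change h M\<^esub> x) = (a * b) \<odot>\<^bsub>base_change h M\<^esub> x"
  by (erule base_change_cases) (simp add: base_change_smult supported_scale)

lemma module_map_base_change:
  assumes "module_map M M' T"
  shows "module_map (base_change h M) (base_change h M') (base_change_map h M' T)"
  unfolding module_map_def
  by (auto elim!: base_change_cases
      simp: base_change_map_class[OF assms] supported_map[OF assms] base_change_add base_change_smult
        carrier_base_change supported_add supported_scale free_map_add free_map_scale)

lemma base_change_map_zero:
  assumes "module_map M M' T"
  shows "base_change_map h M' T \<zero>\<^bsub>base_change h M\<^esub> = \<zero>\<^bsub>base_change h M'\<^esub>"
  by (simp add: base_change_zero base_change_map_class[OF assms])

lemma base_change_map_comp: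
  assumes "module_map M M' S" "module_map M' M'' T" "A \<in> carrier (base_change h M)"
  shows "base_change_map h M'' T (base_change_map h M' S A) = base_change_map h M'' (T \<circ> S) A"
  using assms(3)
  by (elim base_change_cases)
     (simp add: base_change_map_class[OF assms(1)] base_change_map_class[OF assms(2)]
       base_change_map_class[OF module_map_comp[OF assms(1,2)]] supported_map[OF assms(1)]
       free_map_free_map)

text \<open>On a representative, the induced map sees \<open>T\<close> only on the support. This
  serves to iterate the construction: the composition law for Tate modules holds on their carrier,
  and the extension to the l-adic closure must still identify the two maps.\<close>

lemma base_change_map_cong:
  assumes "module_map M M' T" "\<And>x. x \<in> carrier M \<Longrightarrow> T x = S x" "A \<in> carrier (base_change h M)"
    "module_map M M' S"
  shows "base_change_map h M' T A = base_change_map h M' S A"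
  using assms(3)
proof (rule base_change_cases)
  fix \<phi> assume "supported M \<phi>" "A = tensor_class h M \<phi>"
  then show ?thesis
    using assms(2) free_map_cong[of \<phi> T S]
    by (auto simp: base_change_map_class[OF assms(1)] base_change_map_class[OF assms(4)] subset_iff)
qed

lemma base_change_map_id:
  assumes "module_map M M T" "\<And>x. x \<in> carrier M \<Longrightarrow> T x = x" "A \<in> carrier (base_change h M)"
  shows "base_change_map h M T A = A"
  using assms(3)
proof (rule base_change_cases)
  fix \<phi> assume "supported M \<phi>" "A = tensor_class h M \<phi>"
  then show ?thesis
    using assms(2) free_map_cong[of \<phi> T "\<lambda>m. m"]
    by (auto simp: base_change_map_class[OF assms(1)] free_map_id subset_iff)
qed

section \<open>Functoriality of Jacobians and Tate modules\<close>

text \<open>Both function fields share the carrier, the zero and the constants, as is the case for the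
  function fields of \<open>y\<^sup>n = f(x)\<close> and \<open>y\<^sup>n = c f(x)\<close>.\<close>

definition function_field_iso ::
    "('a, 'm) ring_scheme \<Rightarrow> ('a, 'n) ring_scheme \<Rightarrow> 'a set \<Rightarrow> ('a \<Rightarrow> 'a) \<Rightarrow> bool" where
  "function_field_iso F F' k \<alpha> \<longleftrightarrow>
     carrier F' = carrier F \<and> \<zero>\<^bsub>F'\<^esub> = \<zero>\<^bsub>F\<^esub> \<and> \<zero>\<^bsub>F\<^esub> \<in> carrier F \<and> k \<subseteq> carrier F \<and>
     (\<forall>x\<in>carrier F. \<forall>y\<in>carrier F. x \<otimes>\<^bsub>F\<^esub> y \<in> carrier F \<and> x \<oplus>\<^bsub>F\<^esub> y \<in> carrier F) \<and>
     bij_betw \<alpha> (carrier F) (carrier F) \<and> \<alpha> \<zero>\<^bsub>F\<^esub> = \<zero>\<^bsub>F\<^esub> \<and> \<alpha> ` k = k \<and>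
     (\<forall>x\<in>carrier F. \<forall>y\<in>carrier F.
        \<alpha> (x \<otimes>\<^bsub>F\<^esub> y) = \<alpha> x \<otimes>\<^bsub>F'\<^esub> \<alpha> y \<and> \<alpha> (x \<oplus>\<^bsub>F\<^esub> y) = \<alpha> x \<oplus>\<^bsub>F'\<^esub> \<alpha> y)"

lemma function_field_isoD:
  assumes "function_field_iso F F' k \<alpha>"
  shows "carrier F' = carrier F" "\<zero>\<^bsub>F'\<^esub> = \<zero>\<^bsub>F\<^esub>" "\<zero>\<^bsub>F\<^esub> \<in> carrier F" "k \<subseteq> carrier F"
    "bij_betw \<alpha> (carrier F) (carrier F)" "\<alpha> \<zero>\<^bsub>F\<^esub> = \<zero>\<^bsub>F\<^esub>" "\<alpha> ` k = k"
    "x \<in> carrier F \<Longrightarrow> y \<in> carrier F \<Longrightarrow> x \<otimes>\<^bsub>F\<^esub> y \<in> carrier F"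
    "x \<in> carrier F \<Longrightarrow> y \<in> carrier F \<Longrightarrow> x \<oplus>\<^bsub>F\<^esub> y \<in> carrier F"
    "x \<in> carrier F \<Longrightarrow> y \<in> carrier F \<Longrightarrow> \<alpha> (x \<otimes>\<^bsub>F\<^esub> y) = \<alpha> x \<otimes>\<^bsub>F'\<^esub> \<alpha> y"
    "x \<in> carrier F \<Longrightarrow> y \<in> carrier F \<Longrightarrow> \<alpha> (x \<oplus>\<^bsub>F\<^esub> y) = \<alpha> x \<oplus>\<^bsub>F'\<^esub> \<alpha> y"
  using assms unfolding function_field_iso_def by blast+

lemma function_field_iso_carrier:
  assumes "function_field_iso F F' k \<alpha>"
  shows "x \<in> carrier F \<Longrightarrow> \<alpha> x \<in> carrier F"
    and "x \<in> carrier F \<Longrightarrow> inv_into (carrier F) \<alpha> x \<in> carrier F"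
    and "x \<in> carrier F \<Longrightarrow> inv_into (carrier F) \<alpha> (\<alpha> x) = x"
    and "x \<in> carrier F \<Longrightarrow> \<alpha> (inv_into (carrier F) \<alpha> x) = x"
    and "x \<in> carrier F \<Longrightarrow> \<alpha> x = \<zero>\<^bsub>F\<^esub> \<longleftrightarrow> x = \<zero>\<^bsub>F\<^esub>"
    and "x \<in> carrier F \<Longrightarrow> inv_into (carrier F) \<alpha> x = \<zero>\<^bsub>F\<^esub> \<longleftrightarrow> x = \<zero>\<^bsub>F\<^esub>"
proof -
  note b = function_field_isoD(5)[OF assms]
  note z = function_field_isoD(3,6)[OF assms]
  show 1: "x \<in> carrier F \<Longrightarrow> \<alpha> x \<in> carrier F" for x
    using b by (rule bij_betwE[rule_format])
  show 2: "x \<in> carrier F \<Longrightarrow> inv_into (carrier F) \<alpha> x \<in> carrier F" for x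
    using b by (metis bij_betw_imp_surj_on inv_into_into)
  show 3: "x \<in> carrier F \<Longrightarrow> inv_into (carrier F) \<alpha> (\<alpha> x) = x" for x
    using b by (rule bij_betw_inv_into_left)
  show 4: "x \<in> carrier F \<Longrightarrow> \<alpha> (inv_into (carrier F) \<alpha> x) = x" for x
    using b by (rule bij_betw_inv_into_right)
  show "x \<in> carrier F \<Longrightarrow> \<alpha> x = \<zero>\<^bsub>F\<^esub> \<longleftrightarrow> x = \<zero>\<^bsub>F\<^esub>" for x
    using 3 z by metis
  show "x \<in> carrier F \<Longrightarrow> inv_into (carrier F) \<alpha> x = \<zero>\<^bsub>F\<^esub> \<longleftrightarrow> x = \<zero>\<^bsub>F\<^esub>" for x
    using 3 4 z by metis
qed

lemma function_field_iso_comp: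
  assumes "function_field_iso F F' k \<alpha>" "function_field_iso F' F'' k \<beta>"
  shows "function_field_iso F F'' k (\<beta> \<circ> \<alpha>)"
proof -
  note a = function_field_isoD[OF assms(1)]
  note b = function_field_isoD[OF assms(2), unfolded a(1,2)]
  have "(\<beta> \<circ> \<alpha>) ` k = k"
    by (simp only: image_comp[symmetric] a(7) b(7))
  then show ?thesis
    unfolding function_field_iso_def
    using a(3,4) bij_betw_trans[OF a(5) b(5)] function_field_iso_carrier(1)[OF assms(1)]
    by (simp add: a(1,2,6,8-11) b(1,2,6,10,11))
qed

lemma function_field_iso_inv:
  assumes "function_field_iso F F' k \<alpha>"
  shows "function_field_iso F' F k (inv_into (carrier F) \<alpha>)"
proof -
  note a = function_field_isoD[OF assms]
  note c = function_field_iso_carrier[OF assms]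
  let ?b = "inv_into (carrier F) \<alpha>"
  have k: "?b ` k = k"
    using inv_into_image_cancel[OF bij_betw_imp_inj_on[OF a(5)] a(4)] a(7) by simp
  \<comment> \<open>The definition asserts closure for \<open>F\<close> only; for \<open>F'\<close>
    it follows because each sum or product in \<open>F'\<close> is the image of one in
    \<open>F\<close>.\<close>
  have op: "?b (x \<otimes>\<^bsub>F'\<^esub> y) = ?b x \<otimes>\<^bsub>F\<^esub> ?b y" "?b (x \<oplus>\<^bsub>F'\<^esub> y) = ?b x \<oplus>\<^bsub>F\<^esub> ?b y"
    "x \<otimes>\<^bsub>F'\<^esub> y \<in> carrier F" "x \<oplus>\<^bsub>F'\<^esub> y \<in> carrier F"
    if "x \<in> carrier F" "y \<in> carrier F" for x y
  proof -
    have b: "?b x \<in> carrier F" "?b y \<in> carrier F" "\<alpha> (?b x) = x" "\<alpha> (?b y) = y"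
      using that c by blast+
    have m: "\<alpha> (?b x \<otimes>\<^bsub>F\<^esub> ?b y) = x \<otimes>\<^bsub>F'\<^esub> y" "\<alpha> (?b x \<oplus>\<^bsub>F\<^esub> ?b y) = x \<oplus>\<^bsub>F'\<^esub> y"
      using a(10,11)[OF b(1,2)] b by simp_all
    note cl = a(8,9)[OF b(1,2)]
    show "?b (x \<otimes>\<^bsub>F'\<^esub> y) = ?b x \<otimes>\<^bsub>F\<^esub> ?b y" "?b (x \<oplus>\<^bsub>F'\<^esub> y) = ?b x \<oplus>\<^bsub>F\<^esub> ?b y"
      "x \<otimes>\<^bsub>F'\<^esub> y \<in> carrier F" "x \<oplus>\<^bsub>F'\<^esub> y \<in> carrier F"
      unfolding m[symmetric] using c(1,3) cl by blast+
  qed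
  have "?b \<zero>\<^bsub>F\<^esub> = \<zero>\<^bsub>F\<^esub>"
    using c(6) a(3) by blast
  then show ?thesis
    unfolding function_field_iso_def a(1,2)
    using a(3,4) bij_betw_inv_into[OF a(5)] k by (simp add: op)
qed

section \<open>The action on places\<close>

lemma place_map_cong:
  "(\<And>g. g \<in> carrier F \<Longrightarrow> \<alpha> g = \<beta> g) \<Longrightarrow> place_map F \<alpha> v = place_map F \<beta> v"
  by (auto simp: place_map_def inv_into_def fun_eq_iff restrict_def intro!: arg_cong[where f=v] arg_cong[where f=Eps])

lemma place_map_same_carrier:
  "carrier F' = carrier F \<Longrightarrow> \<zero>\<^bsub>F'\<^esub> = \<zero>\<^bsub>F\<^esub> \<Longrightarrow> place_map F' \<alpha> = place_map F \<alpha>"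
  by (simp add: place_map_def fun_eq_iff)

text \<open>The action is covariant: composing a valuation with a map of functions reverses the
  order, and the inverse taken in \<open>place_map\<close> reverses it back.\<close>

lemma place_map_comp:
  assumes "function_field_iso F F' k \<alpha>" "function_field_iso F' F'' k \<beta>"
  shows "place_map F \<beta> (place_map F \<alpha> v) = place_map F (\<beta> \<circ> \<alpha>) v"
proof
  fix g
  note a = function_field_isoD[OF assms(1)]
  note b = function_field_isoD[OF assms(2), unfolded a(1,2)]
  note c = function_field_iso_carrier[OF assms(1)]
  note d = function_field_iso_carrier[OF assms(2), unfolded a(1,2)]
  have "inv_into (carrier F) (\<beta> \<circ> \<alpha>) g = inv_into (carrier F) \<alpha> (inv_into (carrier F) \<beta> g)"
    if "g \<in> carrier F"
  proof (rule inv_into_f_eq)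
    show "inj_on (\<beta> \<circ> \<alpha>) (carrier F)"
      using bij_betw_trans[OF a(5) b(5)] by (simp add: bij_betw_def)
  qed (use that c d in auto)
  then show "place_map F \<beta> (place_map F \<alpha> v) g = place_map F (\<beta> \<circ> \<alpha>) v g"
    using d by (auto simp: place_map_def restrict_def)
qed

lemma place_map_id:
  assumes "v \<in> extensional (carrier F - {\<zero>\<^bsub>F\<^esub>})"
  shows "place_map F (\<lambda>g. g) v = v"
proof
  fix g
  show "place_map F (\<lambda>g. g) v g = v g"
    using assms inv_into_f_f[of "\<lambda>g. g" "carrier F" g]
    by (auto simp: place_map_def restrict_def extensional_def inj_on_def)
qed

text \<open>This includes \<open>g = 0\<close>, where both sides are \<open>undefined\<close>.\<close>

lemma place_map_apply:
  assumes "function_field_iso F F' k \<alpha>" "v \<in> extensional (carrier F - {\<zero>\<^bsub>F\<^esub>})" "g \<in> carrier F"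
  shows "place_map F \<alpha> v (\<alpha> g) = v g"
  using assms(2,3) function_field_iso_carrier[OF assms(1)]
  by (auto simp: place_map_def extensional_def)

text \<open>The new valuation \<open>w\<close> satisfies \<open>w (\<alpha> g) = v g\<close>, and
  \<open>\<alpha>\<close> permutes the nonzero elements. Hence each condition on \<open>w\<close> at
  image points is the corresponding condition on \<open>v\<close>, including that all integers are
  attained.\<close>

lemma place_map_place:
  assumes iso: "function_field_iso F F' k \<alpha>" and v: "v \<in> places F k"
  shows "place_map F \<alpha> v \<in> places F' k"
proof -
  note a = function_field_isoD[OF iso]
  note c = function_field_iso_carrier[OF iso]
  define w where "w = place_map F \<alpha> v"
  have dv: "discrete_valuation F v" and vk: "\<And>a. a \<in> k - {\<zero>\<^bsub>F\<^esub>} \<Longrightarrow> v a = 0"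
    and ext: "v \<in> extensional (carrier F - {\<zero>\<^bsub>F\<^esub>})"
    using v by (auto simp: places_def)
  have w: "w (\<alpha> g) = v g" if "g \<in> carrier F" for g
    using place_map_apply[OF iso ext that] by (simp add: w_def)
  have im: "\<alpha> ` (carrier F - {\<zero>\<^bsub>F\<^esub>}) = carrier F - {\<zero>\<^bsub>F\<^esub>}"
    using inj_on_image_set_diff[OF bij_betw_imp_inj_on[OF a(5)], of "carrier F" "{\<zero>\<^bsub>F\<^esub>}"]
      bij_betw_imp_surj_on[OF a(5)] a(3,6) by auto
  have "discrete_valuation F' w"
    unfolding discrete_valuation_def a(1,2)
  proof (intro conjI ballI)
    fix x y assume "x \<in> carrier F - {\<zero>\<^bsub>F\<^esub>}" "y \<in> carrier F - {\<zero>\<^bsub>F\<^esub>}"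
    then have "x \<in> \<alpha> ` (carrier F - {\<zero>\<^bsub>F\<^esub>})" "y \<in> \<alpha> ` (carrier F - {\<zero>\<^bsub>F\<^esub>})"
      unfolding im .
    then obtain x' y' where xy: "x = \<alpha> x'" "x' \<in> carrier F - {\<zero>\<^bsub>F\<^esub>}"
      "y = \<alpha> y'" "y' \<in> carrier F - {\<zero>\<^bsub>F\<^esub>}"
      by blast
    then have cl: "x' \<in> carrier F" "y' \<in> carrier F" by auto
    have op: "x \<otimes>\<^bsub>F'\<^esub> y = \<alpha> (x' \<otimes>\<^bsub>F\<^esub> y')" "x \<oplus>\<^bsub>F'\<^esub> y = \<alpha> (x' \<oplus>\<^bsub>F\<^esub> y')"
      using a(10,11)[OF cl] xy by simp_all
    note cl' = a(8,9)[OF cl]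
    have v': "v (x' \<otimes>\<^bsub>F\<^esub> y') = v x' + v y'"
      "x' \<oplus>\<^bsub>F\<^esub> y' \<noteq> \<zero>\<^bsub>F\<^esub> \<longrightarrow> min (v x') (v y') \<le> v (x' \<oplus>\<^bsub>F\<^esub> y')"
      using dv xy unfolding discrete_valuation_def by blast+
    show "w (x \<otimes>\<^bsub>F'\<^esub> y) = w x + w y"
      unfolding op using v'(1) by (simp add: xy w cl cl')
    show "x \<oplus>\<^bsub>F'\<^esub> y \<noteq> \<zero>\<^bsub>F\<^esub> \<longrightarrow> min (w x) (w y) \<le> w (x \<oplus>\<^bsub>F'\<^esub> y)"
      unfolding op using v'(2) by (simp add: xy w cl cl' c(5))
  next
    have "w ` \<alpha> ` (carrier F - {\<zero>\<^bsub>F\<^esub>}) = v ` (carrier F - {\<zero>\<^bsub>F\<^esub>})"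
      unfolding image_comp by (rule image_cong) (auto simp: w)
    then show "w ` (carrier F - {\<zero>\<^bsub>F\<^esub>}) = UNIV"
      unfolding im using dv by (simp add: discrete_valuation_def)
  qed
  moreover have "w a' = 0" if "a' \<in> k - {\<zero>\<^bsub>F\<^esub>}" for a'
  proof -
    have "a' \<in> \<alpha> ` k" using that by (simp add: a(7))
    then obtain b where b: "b \<in> k" "a' = \<alpha> b" by blast
    then have "b \<noteq> \<zero>\<^bsub>F\<^esub>" using that a(6) by auto
    then show ?thesis using w[OF subsetD[OF a(4) b(1)]] vk[of b] b by simp
  qed
  moreover have "w \<in> extensional (carrier F - {\<zero>\<^bsub>F\<^esub>})"
    by (simp add: w_def place_map_def)
  ultimately show ?thesis
    using a(1,2) by (simp add: places_def w_def)
qed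

lemma place_map_inv:
  assumes iso: "function_field_iso F F' k \<alpha>" and v: "v \<in> extensional (carrier F - {\<zero>\<^bsub>F\<^esub>})"
  shows "place_map F (inv_into (carrier F) \<alpha>) (place_map F \<alpha> v) = v"
    and "place_map F \<alpha> (place_map F (inv_into (carrier F) \<alpha>) v) = v"
proof -
  note inv = function_field_iso_inv[OF iso]
  note c = function_field_iso_carrier[OF iso]
  have "place_map F (inv_into (carrier F) \<alpha> \<circ> \<alpha>) v = place_map F (\<lambda>g. g) v"
    "place_map F (\<alpha> \<circ> inv_into (carrier F) \<alpha>) v = place_map F (\<lambda>g. g) v"
    by (rule place_map_cong; simp add: c)+
  then show "place_map F (inv_into (carrier F) \<alpha>) (place_map F \<alpha> v) = v"
    "place_map F \<alpha> (place_map F (inv_into (carrier F) \<alpha>) v) = v"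
    using place_map_comp[OF iso inv, of v] place_map_comp[OF inv iso, of v] place_map_id[OF v]
      place_map_same_carrier[of F' F] function_field_isoD(1,2)[OF iso] by simp_all
qed


section \<open>Divisors as formal sums: pushforward, degree, principal divisors\<close>

lemma frag_extend_frag_of:
  fixes p :: "'v \<Rightarrow> 'w"
  shows "frag_extend (\<lambda>v. frag_of (p v)) D = free_map p D"
proof -
  have "frag_cmul c (frag_of x) = Poly_Mapping.single x c" for c and x :: 'w
    by (rule poly_mapping_eqI) (simp add: lookup_single when_def)
  then show ?thesis by (simp add: frag_extend_def free_map_def)
qed

text \<open>The degree is itself a pushforward, namely along the map to a one-point set, so its
  invariance is a case of functoriality.\<close>

lemma divisor_degree_free_map:
  fixes D :: "'a divisor" and p :: "_ \<Rightarrow> 'b \<Rightarrow> int"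
  shows "divisor_degree (free_map p D) = divisor_degree D"
proof -
  have deg: "divisor_degree D = Poly_Mapping.lookup (free_map (\<lambda>_. ()) D) ()"
    "divisor_degree (free_map p D) = Poly_Mapping.lookup (free_map (\<lambda>_. ()) (free_map p D)) ()"
    by (simp_all add: divisor_degree_def free_map_def[of "\<lambda>_. ()"] lookup_sum)
  show ?thesis unfolding deg by (simp add: free_map_free_map comp_def)
qed

lemma lookup_free_map_inj:
  assumes "inj_on p A" "Poly_Mapping.keys D \<subseteq> A" "v \<in> A"
  shows "Poly_Mapping.lookup (free_map p D) (p v) = Poly_Mapping.lookup D v"
proof -
  have "Poly_Mapping.lookup (free_map p D) (p v) =
      (\<Sum>m\<in>Poly_Mapping.keys D. if m = v then Poly_Mapping.lookup D m else 0)"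
    unfolding free_map_def lookup_sum
    by (rule sum.cong) (use assms in \<open>auto simp: lookup_single when_def inj_on_def\<close>)
  then show ?thesis by (simp add: in_keys_iff)
qed

lemma pic0_map_eq: "pic0_map F \<alpha> Y = free_map (place_map F \<alpha>) ` Y"
  by (simp add: pic0_map_def frag_extend_frag_of)

lemma places_extensional: "v \<in> places F k \<Longrightarrow> v \<in> extensional (carrier F - {\<zero>\<^bsub>F\<^esub>})"
  by (simp add: places_def)

lemma free_map_places:
  assumes "function_field_iso F F' k \<alpha>" "Poly_Mapping.keys D \<subseteq> places F k"
  shows "Poly_Mapping.keys (free_map (place_map F \<alpha>) D) \<subseteq> places F' k"
  using keys_free_map[of "place_map F \<alpha>" D] place_map_place[OF assms(1)] assms(2) by blast

text \<open>The divisor of \<open>g\<close> becomes the divisor of \<open>\<alpha> g\<close>: the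
  multiplicity at the image of \<open>v\<close> is \<open>v g\<close>, and this is the value of the
  image of \<open>v\<close> at \<open>\<alpha> g\<close>.\<close>

lemma free_map_principal:
  assumes iso: "function_field_iso F F' k \<alpha>" and D: "D \<in> principal_divisors F k"
  shows "free_map (place_map F \<alpha>) D \<in> principal_divisors F' k"
proof -
  note a = function_field_isoD[OF iso]
  note c = function_field_iso_carrier[OF iso]
  note inv = function_field_iso_inv[OF iso]
  from D obtain g where supp: "Poly_Mapping.keys D \<subseteq> places F k"
    and g: "g \<in> carrier F" "g \<noteq> \<zero>\<^bsub>F\<^esub>" "\<And>v. v \<in> places F k \<Longrightarrow> Poly_Mapping.lookup D v = v g"
    by (auto simp: principal_divisors_def)
  \<comment> \<open>Distinct places have distinct images, so the pushforward never adds up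
    multiplicities.\<close>
  have inj: "inj_on (place_map F \<alpha>) (places F k)"
    by (rule inj_on_inverseI[where g = "place_map F (inv_into (carrier F) \<alpha>)"])
       (rule place_map_inv(1)[OF iso places_extensional])
  have "Poly_Mapping.lookup (free_map (place_map F \<alpha>) D) w = w (\<alpha> g)" if w: "w \<in> places F' k" for w
  proof -
    define v where "v = place_map F (inv_into (carrier F) \<alpha>) w"
    have v: "v \<in> places F k"
      using place_map_place[OF inv w] place_map_same_carrier[of F' F] a(1,2) by (simp add: v_def)
    have wv: "w = place_map F \<alpha> v"
      using place_map_inv(2)[OF iso] places_extensional[OF w] a(1,2) by (simp add: v_def)
    show ?thesis
      unfolding wv
      by (simp add: lookup_free_map_inj[OF inj supp v] g(3)[OF v]
          place_map_apply[OF iso places_extensional[OF v] g(1)])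
  qed
  moreover have "\<alpha> g \<in> carrier F' - {\<zero>\<^bsub>F'\<^esub>}"
    using g c(1,5) a(1,2) by simp
  ultimately show ?thesis
    using free_map_places[OF iso supp] by (auto simp: principal_divisors_def)
qed

lemma free_map_place_map_comp:
  assumes "function_field_iso F F' k \<alpha>" "function_field_iso F' F'' k \<beta>"
  shows "free_map (place_map F'' \<beta>) (free_map (place_map F' \<alpha>) D) = free_map (place_map F'' (\<beta> \<circ> \<alpha>)) D"
  using place_map_comp[OF assms] place_map_same_carrier[of F' F] place_map_same_carrier[of F'' F]
    function_field_isoD(1,2)[OF assms(1)] function_field_isoD(1,2)[OF assms(2)]
  by (simp add: free_map_free_map comp_def)

lemma free_map_place_map_id:
  assumes "Poly_Mapping.keys D \<subseteq> places F k" "\<And>g. g \<in> carrier F \<Longrightarrow> \<alpha> g = g"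
  shows "free_map (place_map F \<alpha>) D = D"
proof -
  have "place_map F \<alpha> v = v" if "v \<in> Poly_Mapping.keys D" for v
    using place_map_cong[of F \<alpha> "\<lambda>g. g" v] assms that
      place_map_id[OF places_extensional, of v F k] by auto
  then show ?thesis
    using free_map_cong[of D "place_map F \<alpha>" "\<lambda>m. m"] by (simp add: free_map_id)
qed

text \<open>An inclusion would not do: a class is a coset and \<open>pic0_map\<close> takes its
  image as a set, so the trivial class must fill the whole trivial class of the target. The other
  inclusion comes from the inverse isomorphism.\<close>

lemma pic0_map_principal:
  assumes iso: "function_field_iso F F' k \<alpha>"
  shows "pic0_map F' \<alpha> (principal_divisors F k) = principal_divisors F' k"
proof (intro equalityI subsetI)
  note a = function_field_isoD[OF iso]
  note inv = function_field_iso_inv[OF iso]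
  have pm: "place_map F' \<beta> = place_map F \<beta>" for \<beta>
    by (rule place_map_same_carrier) (fact a)+
  show "D \<in> principal_divisors F' k" if "D \<in> pic0_map F' \<alpha> (principal_divisors F k)" for D
    using that free_map_principal[OF iso] by (auto simp: pic0_map_eq pm)
  fix D assume D: "D \<in> principal_divisors F' k"
  then have supp: "Poly_Mapping.keys D \<subseteq> places F' k" by (simp add: principal_divisors_def)
  have "free_map (place_map F' \<alpha>) (free_map (place_map F (inv_into (carrier F) \<alpha>)) D) = D"
    unfolding free_map_place_map_comp[OF inv iso]
    by (rule free_map_place_map_id[OF supp])
       (simp add: a(1) function_field_iso_carrier(4)[OF iso])
  moreover have "free_map (place_map F (inv_into (carrier F) \<alpha>)) D \<in> principal_divisors F k"
    using free_map_principal[OF inv D] by (simp add: pm)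
  ultimately show "D \<in> pic0_map F' \<alpha> (principal_divisors F k)"
    unfolding pic0_map_eq by (metis imageI)
qed

section \<open>Divisor classes\<close>

lemma carrier_pic0:
  "carrier (pic0 F k) = (\<lambda>D. (\<lambda>E. E + D) ` principal_divisors F k) `
     {D. Poly_Mapping.keys D \<subseteq> places F k \<and> divisor_degree D = 0}"
  by (auto simp: pic0_def FactGroup_def RCOSETS_def r_coset_def)

lemma mult_pic0: "Y \<otimes>\<^bsub>pic0 F k\<^esub> Z = (\<Union>D\<in>Y. \<Union>E\<in>Z. {D + E})"
  by (simp add: pic0_def FactGroup_def set_mult_def)

lemma one_pic0: "\<one>\<^bsub>pic0 F k\<^esub> = principal_divisors F k"
  by (simp add: pic0_def FactGroup_def)

text \<open>Multiplicativity is required outside the carriers as well; it holds there because the product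
  in \<open>pic0\<close> is the sum of arbitrary sets of divisors. This makes powers compatible with the map
  without any use of the group axioms.\<close>

definition total_hom :: "('g, 'm) monoid_scheme \<Rightarrow> ('g, 'n) monoid_scheme \<Rightarrow> ('g \<Rightarrow> 'g) \<Rightarrow> bool" where
  "total_hom J J' T \<longleftrightarrow> T \<in> carrier J \<rightarrow> carrier J' \<and> T \<one>\<^bsub>J\<^esub> = \<one>\<^bsub>J'\<^esub> \<and>
     (\<forall>x y. T (x \<otimes>\<^bsub>J\<^esub> y) = T x \<otimes>\<^bsub>J'\<^esub> T y)"

lemma total_hom_pic0:
  assumes iso: "function_field_iso F F' k \<alpha>"
  shows "total_hom (pic0 F k) (pic0 F' k) (pic0_map F' \<alpha>)"
proof -
  note a = function_field_isoD[OF iso]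
  have pm: "place_map F' \<alpha> = place_map F \<alpha>"
    by (rule place_map_same_carrier) (fact a)+
  have "pic0_map F' \<alpha> Y \<in> carrier (pic0 F' k)" if Y: "Y \<in> carrier (pic0 F k)" for Y
  proof -
    obtain D where D: "Poly_Mapping.keys D \<subseteq> places F k" "divisor_degree D = 0"
      "Y = (\<lambda>H. H + D) ` principal_divisors F k"
      using Y by (auto simp: carrier_pic0)
    let ?D = "free_map (place_map F \<alpha>) D"
    have "pic0_map F' \<alpha> Y = (\<lambda>H. H + ?D) ` pic0_map F' \<alpha> (principal_divisors F k)"
      by (simp add: D(3) pic0_map_eq pm image_image free_map_add)
    then have "pic0_map F' \<alpha> Y = (\<lambda>H. H + ?D) ` principal_divisors F' k"
      by (simp add: pic0_map_principal[OF iso])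
    then show ?thesis
      using free_map_places[OF iso D(1)] D(2)
      by (auto simp: carrier_pic0 divisor_degree_free_map)
  qed
  then show ?thesis
    by (simp add: total_hom_def one_pic0 pic0_map_principal[OF iso] mult_pic0)
       (simp add: pic0_map_eq image_UN free_map_add)
qed

lemma pic0_map_comp:
  assumes "function_field_iso F F' k \<alpha>" "function_field_iso F' F'' k \<beta>"
  shows "pic0_map F'' \<beta> (pic0_map F' \<alpha> Y) = pic0_map F'' (\<beta> \<circ> \<alpha>) Y"
  by (simp add: pic0_map_eq image_image free_map_place_map_comp[OF assms])

lemma pic0_map_id:
  assumes "Y \<in> carrier (pic0 F k)"
  shows "pic0_map F (\<lambda>g. g) Y = Y"
proof -
  have "free_map (place_map F (\<lambda>g. g)) D = D" if "D \<in> Y" for D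
  proof (rule free_map_place_map_id)
    obtain E where E: "Poly_Mapping.keys E \<subseteq> places F k" "Y = (\<lambda>H. H + E) ` principal_divisors F k"
      using assms by (auto simp: carrier_pic0)
    obtain H where "D = H + E" "H \<in> principal_divisors F k"
      using \<open>D \<in> Y\<close> unfolding E(2) by blast
    then show "Poly_Mapping.keys D \<subseteq> places F k"
      using Poly_Mapping.keys_add[of H E] E(1) by (auto simp: principal_divisors_def)
  qed simp
  then show ?thesis by (simp add: pic0_map_eq)
qed

section \<open>Tate modules and their extension to the l-adic numbers\<close>

lemma total_hom_nat_pow:
  assumes "total_hom J J' T"
  shows "T (x [^]\<^bsub>J\<^esub> (m::nat)) = T x [^]\<^bsub>J'\<^esub> m"
  using assms by (induction m) (simp_all add: total_hom_def)

lemma module_map_tate: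
  assumes T: "total_hom J J' T"
  shows "module_map (tate_module J :: ('l::prime_card ladic_int, _) module) (tate_module J') (\<lambda>x n. T (x n))"
proof -
  have "T (x [^]\<^bsub>J\<^esub> ladic_residue a n) = T x [^]\<^bsub>J'\<^esub> ladic_residue a n" for x n and a :: "'l ladic_int"
  proof -
    \<comment> \<open>Scalars act through integer powers, whose definition branches on the sign;
      residues are chosen nonnegative, so only natural powers occur.\<close>
    have "\<not> ladic_residue a n < 0" using ladic_residue[of a] by (simp add: not_less)
    then show ?thesis
      by (simp only: int_pow_def2 if_False total_hom_nat_pow[OF T])
  qed
  moreover have "T (x n) \<in> carrier J' \<and> T (x n) [^]\<^bsub>J'\<^esub> (CARD('l) ^ n) = \<one>\<^bsub>J'\<^esub> \<and>
                       T (x (Suc n)) [^]\<^bsub>J'\<^esub> CARD('l) = T (x n)"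
    if "x n \<in> carrier J \<and> x n [^]\<^bsub>J\<^esub> (CARD('l) ^ n) = \<one>\<^bsub>J\<^esub> \<and>
                       x (Suc n) [^]\<^bsub>J\<^esub> CARD('l) = x n" for x n
    using that T unfolding total_hom_nat_pow[OF T, symmetric] by (auto simp: total_hom_def)
  ultimately show ?thesis
    using T by (auto simp: module_map_def tate_module_def total_hom_def)
qed

abbreviation rational_tate :: "nat \<Rightarrow> 'k::field poly \<Rightarrow>
    ('l::prime_card ladic_rat, ((nat \<Rightarrow> 'k curve_fun divisor set) \<Rightarrow>\<^sub>0 'l ladic_rat) set) module" where
  "rational_tate n f \<equiv> rational_tate_module (jacobian n f)"

lemma module_map_jacobian_tate:
  assumes "function_field_iso (function_field n f) (function_field n f') curve_constants \<alpha>"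
  shows "module_map (rational_tate n f) (rational_tate n f') (jacobian_tate_map n f' \<alpha>)"
  using module_map_base_change[OF module_map_tate[OF total_hom_pic0[OF assms]]]
  by (simp add: rational_tate_module_def jacobian_tate_map_def rational_tate_map_def jacobian_def)

lemma jacobian_tate_map_comp:
  assumes "function_field_iso (function_field n f) (function_field n f') curve_constants \<alpha>"
    and "function_field_iso (function_field n f') (function_field n f'') curve_constants \<beta>"
    and "x \<in> carrier (rational_tate n f)"
  shows "jacobian_tate_map n f'' \<beta> (jacobian_tate_map n f' \<alpha> x) = jacobian_tate_map n f'' (\<beta> \<circ> \<alpha>) x"
  using base_change_map_comp[OF module_map_tate[OF total_hom_pic0[OF assms(1)]]
      module_map_tate[OF total_hom_pic0[OF assms(2)]]] assms(3)
  by (simp add: rational_tate_module_def jacobian_tate_map_def rational_tate_map_def jacobian_def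
      comp_def pic0_map_comp[OF assms(1,2)])

lemma jacobian_tate_map_id:
  fixes x :: "(_ \<Rightarrow>\<^sub>0 'l::prime_card ladic_rat) set"
  assumes "function_field_iso (function_field n f) (function_field n f) curve_constants (\<lambda>g. g)"
    and "x \<in> carrier (rational_tate n f)"
  shows "jacobian_tate_map n f (\<lambda>g. g) x = x"
proof -
  have "(\<lambda>m. pic0_map (function_field n f) (\<lambda>g. g) (y m)) = y"
    if "y \<in> carrier (tate_module (jacobian n f) :: ('l ladic_int, _) module)" for y
    using that
    by (intro ext pic0_map_id[where k = curve_constants]) (simp add: tate_module_def jacobian_def)
  then show ?thesis
    using base_change_map_id[OF module_map_tate[OF total_hom_pic0[OF assms(1)]], of x to_fract] assms(2)
    by (simp add: rational_tate_module_def jacobian_tate_map_def rational_tate_map_def jacobian_def)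
qed

section \<open>Isomorphisms of superelliptic function fields\<close>

lemma degree_curve_equation: "n > 0 \<Longrightarrow> degree (curve_equation n f) = n"
  unfolding curve_equation_def
  by (subst diff_conv_add_uminus, subst degree_add_eq_left) (simp_all add: degree_monom_eq)

text \<open>\<open>\<alpha>\<close> takes one modulus to a constant multiple of the other and
  preserves degrees, so it takes division with remainder to division with remainder. It therefore
  commutes with reduction, which is all that separates products in the function field from products
  of polynomials.\<close>

lemma function_field_isoI:
  fixes \<alpha> :: "'k::field curve_fun \<Rightarrow> 'k curve_fun"
  assumes n: "n > 0" and bij: "bij \<alpha>"
    and add: "\<And>g h. \<alpha> (g + h) = \<alpha> g + \<alpha> h"
    and mult: "\<And>g h. \<alpha> (g * h) = \<alpha> g * \<alpha> h"
    and deg: "\<And>g. degree (\<alpha> g) = degree g"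
    and const: "\<alpha> ` curve_constants = curve_constants"
    and eq: "\<alpha> (curve_equation n f) = smult u (curve_equation n f')"
  shows "function_field_iso (function_field n f) (function_field n f') curve_constants \<alpha>"
proof -
  let ?m = "curve_equation n f" and ?m' = "curve_equation n f'"
  have dm: "degree ?m = n" "degree ?m' = n" and nz: "?m \<noteq> 0" "?m' \<noteq> 0"
    using degree_curve_equation[OF n, of f] degree_curve_equation[OF n, of f'] n by auto
  have small: "degree (g mod ?m) < n" for g
    using degree_mod_less[OF nz(1), of g] dm n by auto
  have "\<alpha> (g mod ?m) = \<alpha> g mod ?m'" for g
  proof -
    have "\<alpha> g = \<alpha> (g div ?m * ?m + g mod ?m)" by (simp only: div_mult_mod_eq)
    then have "\<alpha> g = smult u (\<alpha> (g div ?m)) * ?m' + \<alpha> (g mod ?m)"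
      by (simp add: add mult eq)
    then show ?thesis
      using small[of g] by (simp add: mod_poly_less deg dm poly_mod_add_left mod_smult_left)
  qed
  moreover have "\<alpha> 0 = 0"
    using add[of 0 0] by (simp only: add_0_left add_cancel_right_right)
  moreover have "bij_betw \<alpha> {g. degree g < n} {g. degree g < n}"
  proof (rule bij_betw_imageI)
    show "inj_on \<alpha> {g. degree g < n}"
      using bij by (meson bij_is_inj inj_on_subset subset_UNIV)
    show "\<alpha> ` {g. degree g < n} = {g. degree g < n}"
    proof (intro equalityI subsetI)
      fix g :: "'k curve_fun" assume "g \<in> {g. degree g < n}"
      moreover have "g = \<alpha> (inv_into UNIV \<alpha> g)" using bij by (simp add: bij_is_surj surj_f_inv_f)
      ultimately show "g \<in> \<alpha> ` {g. degree g < n}" using deg by (metis imageI mem_Collect_eq)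
    qed (auto simp: deg)
  qed
  ultimately show ?thesis
    using n const small
    by (auto simp: function_field_iso_def function_field_def add mult curve_constants_def degree_add_less)
qed

section \<open>Rescaling the coordinate y\<close>

abbreviation const_fun :: "'k::field alg_closure \<Rightarrow> 'k alg_closure poly fract" where
  "const_fun a \<equiv> to_fract [:a:]"

lemma const_fun_mult: "const_fun (a * b) = const_fun a * const_fun b"
  by (simp flip: to_fract_mult)

lemma const_fun_power: "const_fun (a ^ i) = const_fun a ^ i"
  by (induction i) (simp_all add: const_fun_mult flip: one_pCons)

text \<open>The substitution of \<open>mu_action\<close>, with the factor taken from the algebraic
  closure, where \<open>\<delta>\<close> lives.\<close>

definition scale_y :: "'k::field alg_closure \<Rightarrow> 'k curve_fun \<Rightarrow> 'k curve_fun" where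
  "scale_y a g = pcompose g [:0, const_fun a:]"

lemma mu_action_scale_y: "mu_action z = scale_y (to_ac z)"
  by (simp add: fun_eq_iff mu_action_def scale_y_def)

lemma coeff_scale_y: "coeff (scale_y a g) i = const_fun a ^ i * coeff g i"
  by (simp add: scale_y_def coeff_pcompose_linear)

lemma scale_y_scale_y: "scale_y a (scale_y b g) = scale_y (a * b) g"
  by (rule poly_eqI) (simp add: coeff_scale_y const_fun_mult power_mult_distrib mult_ac)

lemma scale_y_one: "scale_y 1 g = g"
  by (rule poly_eqI) (simp add: coeff_scale_y flip: one_pCons)

lemma function_field_iso_scale_y:
  fixes f f' :: "'k::field poly"
  assumes n: "n > 0" and a: "a \<noteq> 0"
    and f: "map_poly to_ac f = smult (a ^ n) (map_poly to_ac f')"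
  shows "function_field_iso (function_field n f) (function_field n f') curve_constants (scale_y a)"
proof (rule function_field_isoI[OF n])
  show "bij (scale_y a)"
    by (rule bij_betw_byWitness[where f' = "scale_y (inverse a)"])
       (simp_all add: scale_y_scale_y a scale_y_one)
  show "scale_y a ` curve_constants = curve_constants"
    by (simp add: curve_constants_def scale_y_def image_image)
  show "scale_y a (curve_equation n f) = smult (const_fun a ^ n) (curve_equation n f')"
  proof (rule poly_eqI)
    fix i
    have "to_fract (map_poly to_ac f) = const_fun a ^ n * to_fract (map_poly to_ac f')"
      unfolding f by (simp flip: const_fun_power to_fract_mult)
    then show "coeff (scale_y a (curve_equation n f)) i = coeff (smult (const_fun a ^ n) (curve_equation n f')) i"
      \<comment> \<open>The coefficient of index 0 contains the polynomial and uses its relation to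
        the other one; above it only the term \<open>y ^ n\<close> contributes.\<close>
      using n by (cases i) (simp_all add: coeff_scale_y curve_equation_def)
  qed
qed (use a in \<open>simp_all add: scale_y_def pcompose_add pcompose_mult degree_pcompose\<close>)

section \<open>Lifting automorphisms of the constants to the function field\<close>

definition ring_auto :: "('a::idom \<Rightarrow> 'a) \<Rightarrow> bool" where
  "ring_auto h \<longleftrightarrow> bij h \<and> (\<forall>x y. h (x + y) = h x + h y) \<and> (\<forall>x y. h (x * y) = h x * h y)"

lemma ring_autoD:
  assumes "ring_auto h"
  shows "h (x + y) = h x + h y" "h (x * y) = h x * h y" "h 0 = 0" "h 1 = 1" "h x = 0 \<longleftrightarrow> x = 0"
    "h (x ^ i) = h x ^ i" "h (sum g A) = (\<Sum>x\<in>A. h (g x))" "h (- x) = - h x" "h (x - y) = h x - h y"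
    "inv_into UNIV h (h x) = x" "h (inv_into UNIV h x) = x"
proof -
  show a: "h (x + y) = h x + h y" and m: "h (x * y) = h x * h y" for x y
    using assms by (auto simp: ring_auto_def)
  have bij: "bij h" using assms by (simp add: ring_auto_def)
  show z: "h 0 = 0"
    using a[of 0 0] by (simp only: add_0_left add_cancel_right_right)
  show zi: "h x = 0 \<longleftrightarrow> x = 0" for x
    using bij z by (metis bij_pointE)
  \<comment> \<open>\<open>h 1\<close> is idempotent and, by injectivity, nonzero.\<close>
  show o: "h 1 = 1" using m[of 1 1] zi[of 1] by simp
  show "h (x ^ i) = h x ^ i" by (induction i) (simp_all add: o m)
  show "h (sum g A) = (\<Sum>x\<in>A. h (g x))"
    by (induction A rule: infinite_finite_induct) (simp_all add: z a)
  show u: "h (- x) = - h x" for x using a[of x "- x"] z by (simp add: add_eq_0_iff)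
  show "h (x - y) = h x - h y" using a[of x "- y"] u by simp
  show "inv_into UNIV h (h x) = x" using bij by (simp add: bij_is_inj)
  show "h (inv_into UNIV h x) = x" using bij by (simp add: bij_is_surj surj_f_inv_f)
qed

lemma ring_autoI:
  assumes "\<And>x y. h (x + y) = h x + h y" "\<And>x y. h (x * y) = h x * h y"
    "\<And>x. h' (h x) = x" "\<And>x. h (h' x) = x"
  shows "ring_auto h"
  using assms bij_betw_byWitness[of UNIV h' h UNIV] by (simp add: ring_auto_def)

lemma ring_auto_inv:
  assumes "ring_auto h"
  shows "ring_auto (inv_into UNIV h)"
proof (rule ring_autoI[where h' = h])
  fix x y
  show "inv_into UNIV h (x + y) = inv_into UNIV h x + inv_into UNIV h y" "inv_into UNIV h (x * y) = inv_into UNIV h x * inv_into UNIV h y"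
    using ring_autoD(1,2)[OF assms, of "inv_into UNIV h x" "inv_into UNIV h y"] by (metis ring_autoD(10,11)[OF assms])+
qed (simp_all add: ring_autoD[OF assms])

text \<open>Used at two levels of \<open>galois_action\<close>: for polynomials in x over the
  constants and, after passing to fractions, for polynomials in y over the rational
  functions.\<close>

lemma ring_auto_map_poly:
  assumes "ring_auto h"
  shows "ring_auto (map_poly h)"
proof (rule ring_autoI[where h' = "map_poly (inv_into UNIV h)"])
  note h = ring_autoD[OF assms]
  note i = ring_autoD[OF ring_auto_inv[OF assms]]
  fix p q
  show "map_poly h (p + q) = map_poly h p + map_poly h q"
    by (rule poly_eqI) (simp add: coeff_map_poly h)
  show "map_poly h (p * q) = map_poly h p * map_poly h q"
    by (rule poly_eqI) (simp add: coeff_map_poly coeff_mult h)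
  show "map_poly (inv_into UNIV h) (map_poly h p) = p" "map_poly h (map_poly (inv_into UNIV h) p) = p"
    by (rule poly_eqI; simp add: coeff_map_poly h(3,10,11) i(3))+
qed

text \<open>The definite description ranges over all ways to write the fraction. An automorphism
  respects cross multiplication and keeps denominators nonzero, so all of them yield the same
  value.\<close>

lemma map_fract_Fract:
  assumes "ring_auto h" "b \<noteq> 0"
  shows "map_fract h (Fraction_Field.Fract a b) = Fraction_Field.Fract (h a) (h b)"
  unfolding map_fract_def
proof (rule the_equality)
  note h = ring_autoD[OF assms(1)]
  show "\<exists>a' b'. b' \<noteq> 0 \<and> Fraction_Field.Fract a b = Fraction_Field.Fract a' b' \<and>
      Fraction_Field.Fract (h a) (h b) = Fraction_Field.Fract (h a') (h b')"
    using assms(2) by blast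
  fix w
  assume "\<exists>a' b'. b' \<noteq> 0 \<and> Fraction_Field.Fract a b = Fraction_Field.Fract a' b' \<and>
      w = Fraction_Field.Fract (h a') (h b')"
  then obtain a' b' where *: "b' \<noteq> 0" "a * b' = a' * b" "w = Fraction_Field.Fract (h a') (h b')"
    using assms(2) by (auto simp: eq_fract)
  have "h a' * h b = h a * h b'"
    using arg_cong[OF *(2), of h] by (simp add: h(2))
  then show "w = Fraction_Field.Fract (h a) (h b)"
    using * assms(2) by (simp add: eq_fract h(5))
qed

lemma ring_auto_map_fract:
  assumes "ring_auto h"
  shows "ring_auto (map_fract h)"
proof (rule ring_autoI[where h' = "map_fract (inv_into UNIV h)"])
  note h = ring_autoD[OF assms] map_fract_Fract[OF assms]
  note i = ring_autoD[OF ring_auto_inv[OF assms]] map_fract_Fract[OF ring_auto_inv[OF assms]]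
  fix p q :: "'a fract"
  obtain a b where p: "p = Fraction_Field.Fract a b" "b \<noteq> 0" by (cases p)
  obtain c d where q: "q = Fraction_Field.Fract c d" "d \<noteq> 0" by (cases q)
  show "map_fract h (p + q) = map_fract h p + map_fract h q"
    "map_fract h (p * q) = map_fract h p * map_fract h q"
    using p(2) q(2) by (simp_all add: p q h(1,2,5,12))
  show "map_fract (inv_into UNIV h) (map_fract h p) = p" "map_fract h (map_fract (inv_into UNIV h) p) = p"
    using p(2) by (simp_all add: p h(5,10,11,12) i(5,12))
qed

definition galois_auto :: "('k::field alg_closure \<Rightarrow> 'k alg_closure) \<Rightarrow> bool" where
  "galois_auto \<sigma> \<longleftrightarrow> ring_auto \<sigma> \<and> (\<forall>x. \<sigma> (to_ac x) = to_ac x)"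

lemma absolute_galois_groupD:
  assumes "\<sigma> \<in> carrier absolute_galois_group"
  shows "galois_auto \<sigma>"
  using assms
  by (auto simp: absolute_galois_group_def galois_group_def galois_auto_def ring_auto_def Bij_def
      Ring.ring_hom_def ring_of_type_algebra_def base_field_def)

lemma ring_auto_galois_action: "ring_auto \<sigma> \<Longrightarrow> ring_auto (galois_action \<sigma>)"
  unfolding galois_action_def by (intro ring_auto_map_poly ring_auto_map_fract)

lemma map_fract_to_fract:
  assumes "ring_auto h"
  shows "map_fract h (to_fract a) = to_fract (h a)"
  using map_fract_Fract[OF assms, of 1 a] by (simp add: to_fract_def ring_autoD[OF assms])

lemma map_fract_const_fun:
  assumes "ring_auto \<sigma>"
  shows "map_fract (map_poly \<sigma>) (const_fun a) = const_fun (\<sigma> a)"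
proof -
  have "map_poly \<sigma> [:a:] = [:\<sigma> a:]"
    by (rule poly_eqI) (simp add: coeff_map_poly coeff_pCons ring_autoD(3)[OF assms] split: nat.split)
  then show ?thesis
    using map_fract_to_fract[OF ring_auto_map_poly[OF assms], of "[:a:]"] by simp
qed

lemma coeff_galois_action:
  assumes "ring_auto \<sigma>"
  shows "coeff (galois_action \<sigma> g) i = map_fract (map_poly \<sigma>) (coeff g i)"
  unfolding galois_action_def
  by (rule coeff_map_poly) (rule ring_autoD(3)[OF ring_auto_map_fract[OF ring_auto_map_poly[OF assms]]])

text \<open>This is the source of the twist: moving Galois past a rescaling applies
  \<open>\<sigma>\<close> to the factor. Factors from K are unaffected, while
  \<open>\<delta>\<close> picks up a root of unity.\<close>

lemma galois_action_scale_y: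
  assumes "ring_auto \<sigma>"
  shows "galois_action \<sigma> (scale_y a g) = scale_y (\<sigma> a) (galois_action \<sigma> g)"
proof (rule poly_eqI)
  note m = ring_autoD[OF ring_auto_map_fract[OF ring_auto_map_poly[OF assms]]]
  show "coeff (galois_action \<sigma> (scale_y a g)) i = coeff (scale_y (\<sigma> a) (galois_action \<sigma> g)) i" for i
    by (simp add: coeff_galois_action[OF assms] coeff_scale_y m(2,6) map_fract_const_fun[OF assms])
qed

text \<open>Galois moves the constants, which is why \<open>function_field_iso\<close> preserves
  them as a set and not pointwise. The curve equation is fixed because its coefficients come from
  K.\<close>

lemma function_field_iso_galois_action:
  assumes n: "n > 0" and "galois_auto \<sigma>"
  shows "function_field_iso (function_field n f) (function_field n f) curve_constants (galois_action \<sigma>)"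
proof (rule function_field_isoI[OF n])
  have \<sigma>: "ring_auto \<sigma>" and K: "\<sigma> (to_ac x) = to_ac x" for x
    using assms(2) by (auto simp: galois_auto_def)
  note r = ring_auto_galois_action[OF \<sigma>]
  note m = ring_auto_map_fract[OF ring_auto_map_poly[OF \<sigma>]]
  show "bij (galois_action \<sigma>)" using r by (simp add: ring_auto_def)
  show "galois_action \<sigma> (g + h) = galois_action \<sigma> g + galois_action \<sigma> h"
    "galois_action \<sigma> (g * h) = galois_action \<sigma> g * galois_action \<sigma> h" for g h
    by (rule ring_autoD[OF r])+
  show "degree (galois_action \<sigma> g) = degree g" for g
    unfolding galois_action_def by (rule degree_map_poly) (simp add: ring_autoD(5)[OF m])
  have c: "galois_action \<sigma> [:const_fun a:] = [:const_fun (\<sigma> a):]" for a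
    by (rule poly_eqI)
       (simp add: coeff_galois_action[OF \<sigma>] coeff_pCons ring_autoD(3)[OF m] map_fract_const_fun[OF \<sigma>]
         split: nat.split)
  have surj: "range \<sigma> = UNIV" using \<sigma> by (simp add: ring_auto_def bij_is_surj)
  have "range (\<lambda>a. [:const_fun (\<sigma> a):]) = (\<lambda>a. [:const_fun a:]) ` range \<sigma>"
    by (simp only: image_image)
  then show "galois_action \<sigma> ` curve_constants = curve_constants"
    unfolding curve_constants_def image_image c surj .
  have "map_poly \<sigma> (map_poly to_ac f) = map_poly to_ac f"
    by (rule poly_eqI) (simp add: coeff_map_poly ring_autoD(3)[OF \<sigma>] K)
  then have "map_fract (map_poly \<sigma>) (to_fract (map_poly to_ac f)) = to_fract (map_poly to_ac f)"
    by (simp add: map_fract_to_fract[OF ring_auto_map_poly[OF \<sigma>]])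
  then have "galois_action \<sigma> (curve_equation n f) = curve_equation n f"
    by (intro poly_eqI)
       (simp add: coeff_galois_action[OF \<sigma>] curve_equation_def coeff_pCons ring_autoD[OF m]
         split: nat.split)
  then show "galois_action \<sigma> (curve_equation n f) = smult 1 (curve_equation n f)" by simp
qed

section \<open>New parts and eigenspaces\<close>

text \<open>Horner evaluation is a fold, so the proof is an induction on the coefficient list.
  Membership in the carrier is carried along, because \<open>S\<close> is compatible with the
  operations only there.\<close>

lemma poly_apply_natural:
  assumes S: "module_map V V' S" "S \<zero>\<^bsub>V\<^esub> = \<zero>\<^bsub>V'\<^esub>"
    and T: "\<And>x. x \<in> carrier V \<Longrightarrow> T x \<in> carrier V" "\<And>x. x \<in> carrier V \<Longrightarrow> S (T x) = T' (S x)"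
    and closed: "\<zero>\<^bsub>V\<^esub> \<in> carrier V" "\<And>x y. x \<in> carrier V \<Longrightarrow> y \<in> carrier V \<Longrightarrow> x \<oplus>\<^bsub>V\<^esub> y \<in> carrier V"
      "\<And>a x. x \<in> carrier V \<Longrightarrow> a \<odot>\<^bsub>V\<^esub> x \<in> carrier V"
    and v: "v \<in> carrier V"
  shows "S (poly_apply V P T v) = poly_apply V' P T' (S v)"
proof -
  define F where "F = (\<lambda>(a::int) w. (of_int a \<odot>\<^bsub>V\<^esub> v) \<oplus>\<^bsub>V\<^esub> T w)"
  define F' where "F' = (\<lambda>(a::int) w. (of_int a \<odot>\<^bsub>V'\<^esub> S v) \<oplus>\<^bsub>V'\<^esub> T' w)"
  have "foldr F as \<zero>\<^bsub>V\<^esub> \<in> carrier V \<and> S (foldr F as \<zero>\<^bsub>V\<^esub>) = foldr F' as \<zero>\<^bsub>V'\<^esub>" for as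
    by (induction as) (simp_all add: F_def F'_def S(2) T closed v module_mapD[OF S(1)])
  then show ?thesis by (simp add: poly_apply_def fold_coeffs_def F_def F'_def)
qed

text \<open>Commuting with \<open>t\<close> is what makes an isomorphism respect the kernel of the
  cyclotomic polynomial in \<open>t\<close> and the eigenspaces of \<open>t\<close>. Rescalings,
  Galois and the powers of \<open>t\<close> all have this property.\<close>

definition equivariant_iso ::
    "nat \<Rightarrow> 'k::field poly \<Rightarrow> 'k poly \<Rightarrow> 'k \<Rightarrow> ('k curve_fun \<Rightarrow> 'k curve_fun) \<Rightarrow> bool" where
  "equivariant_iso d f f' z \<alpha> \<longleftrightarrow>
     function_field_iso (function_field d f) (function_field d f') curve_constants \<alpha> \<and>
     \<alpha> \<circ> mu_action z = mu_action z \<circ> \<alpha>"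

lemma equivariant_isoD:
  "equivariant_iso d f f' z \<alpha> \<Longrightarrow>
     function_field_iso (function_field d f) (function_field d f') curve_constants \<alpha>"
  by (simp add: equivariant_iso_def)

lemma equivariant_iso_comp:
  assumes "equivariant_iso d f f' z \<alpha>" "equivariant_iso d f' f'' z \<beta>"
  shows "equivariant_iso d f f'' z (\<beta> \<circ> \<alpha>)"
proof -
  have "\<beta> \<circ> \<alpha> \<circ> mu_action z = mu_action z \<circ> (\<beta> \<circ> \<alpha>)"
    using assms by (simp add: equivariant_iso_def fun_eq_iff)
  then show ?thesis
    using function_field_iso_comp[OF equivariant_isoD[OF assms(1)] equivariant_isoD[OF assms(2)]]
    by (simp add: equivariant_iso_def)
qed

lemma equivariant_iso_scale_y:
  fixes f f' :: "'k::field poly"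
  assumes "d > 0" "a \<noteq> 0" "map_poly to_ac f = smult (a ^ d) (map_poly to_ac f')"
  shows "equivariant_iso d f f' z (scale_y a)"
  using function_field_iso_scale_y[OF assms]
  by (simp add: equivariant_iso_def fun_eq_iff mu_action_scale_y scale_y_scale_y mult.commute)

lemma equivariant_iso_galois_action:
  assumes "d > 0" "galois_auto \<sigma>"
  shows "equivariant_iso d f f z (galois_action \<sigma>)"
  using function_field_iso_galois_action[OF assms] assms(2)
  by (simp add: equivariant_iso_def fun_eq_iff mu_action_scale_y galois_action_scale_y galois_auto_def)

lemma equivariant_iso_mu_action:
  fixes z w :: "'k::field"
  assumes "d > 0" "w ^ d = 1"
  shows "equivariant_iso d f f z (mu_action w)"
proof -
  have "w \<noteq> 0" using assms by (auto simp: zero_power)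
  moreover have "to_ac w ^ d = 1" using assms(2) by (metis to_ac_1 to_ac_power)
  ultimately show ?thesis
    using assms(1) by (simp add: mu_action_scale_y equivariant_iso_scale_y)
qed

lemma carrier_new_part:
  "carrier (new_part d f z) = {x \<in> carrier (rational_tate d f).
     poly_apply (rational_tate d f) (cyclotomic d) (jacobian_tate_map d f (mu_action z)) x
       = \<zero>\<^bsub>rational_tate d f\<^esub>}"
  by (simp add: new_part_def Let_def)

text \<open>The induced map intertwines the two actions of \<open>t\<close>, hence every integer
  polynomial in them; for the cyclotomic polynomial this says that kernel goes to kernel.\<close>

lemma module_map_new_part:
  fixes f f' :: "'k::field poly"
  assumes d: "d > 0" and z: "z ^ d = 1" and \<alpha>: "equivariant_iso d f f' z \<alpha>"
  shows "module_map (new_part d f z :: ('l::prime_card ladic_rat, _) module) (new_part d f' z)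
    (jacobian_tate_map d f' \<alpha>)"
proof -
  let ?V = "rational_tate d f :: ('l ladic_rat, _) module"
  let ?V' = "rational_tate d f' :: ('l ladic_rat, _) module"
  let ?S = "jacobian_tate_map d f' \<alpha> :: (_ \<Rightarrow>\<^sub>0 'l ladic_rat) set \<Rightarrow> _"
  have iso: "function_field_iso (function_field d f) (function_field d f') curve_constants \<alpha>"
    using \<alpha> by (rule equivariant_isoD)
  have mu: "function_field_iso (function_field d g) (function_field d g) curve_constants (mu_action z)" for g
    using equivariant_isoD[OF equivariant_iso_mu_action[OF d z]] .
  note S = module_map_jacobian_tate[OF iso, where 'b = 'l]
  have "?S (poly_apply ?V P (jacobian_tate_map d f (mu_action z)) x) =
      poly_apply ?V' P (jacobian_tate_map d f' (mu_action z)) (?S x)"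
    if "x \<in> carrier ?V" for P x
  proof (rule poly_apply_natural[OF S])
    show "?S \<zero>\<^bsub>?V\<^esub> = \<zero>\<^bsub>?V'\<^esub>"
      using base_change_map_zero[OF module_map_tate[OF total_hom_pic0[OF iso]]]
      by (simp add: rational_tate_module_def jacobian_tate_map_def rational_tate_map_def jacobian_def)
    show "jacobian_tate_map d f (mu_action z) y \<in> carrier ?V" if "y \<in> carrier ?V" for y
      using module_mapD(1)[OF module_map_jacobian_tate[OF mu] that] .
    show "?S (jacobian_tate_map d f (mu_action z) y) = jacobian_tate_map d f' (mu_action z) (?S y)"
      if "y \<in> carrier ?V" for y
      using jacobian_tate_map_comp[OF mu iso that] jacobian_tate_map_comp[OF iso mu that] \<alpha>
      by (simp add: equivariant_iso_def)
  qed (use that in \<open>simp_all add: rational_tate_module_def base_change_closed\<close>)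
  moreover have "?S \<zero>\<^bsub>?V\<^esub> = \<zero>\<^bsub>?V'\<^esub>"
    using base_change_map_zero[OF module_map_tate[OF total_hom_pic0[OF iso]]]
    by (simp add: rational_tate_module_def jacobian_tate_map_def rational_tate_map_def jacobian_def)
  ultimately have "?S x \<in> carrier (new_part d f' z)" if "x \<in> carrier (new_part d f z)" for x
    using that module_mapD(1)[OF S] unfolding carrier_new_part mem_Collect_eq by metis
  moreover have "x \<in> carrier ?V" if "x \<in> carrier (new_part d f z)" for x
    using that by (simp add: carrier_new_part)
  moreover have "add (new_part d g z) = add (rational_tate d g)"
    "module.smult (new_part d g z) = module.smult (rational_tate d g)" for g :: "'k poly"
    by (simp_all add: new_part_def Let_def)
  ultimately show ?thesis
    unfolding module_map_def using module_mapD(2,3)[OF S] by (metis (no_types, lifting) Pi_I)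
qed

lemma module_map_new_part_ext:
  assumes "d > 0" "z ^ d = 1" "equivariant_iso d f f' z \<alpha>"
  shows "module_map (new_part_ext d f z :: ('l::prime_card ladic_closure, _) module)
    (new_part_ext d f' z) (new_part_ext_map d f' z \<alpha>)"
  unfolding new_part_ext_def new_part_ext_map_def
  by (rule module_map_base_change[OF module_map_new_part[OF assms]])

lemma new_part_ext_map_comp:
  fixes x :: "('k::field, 'l::prime_card) tate_vector"
  assumes d: "d > 0" "z ^ d = 1" and \<alpha>: "equivariant_iso d f f' z \<alpha>" and \<beta>: "equivariant_iso d f' f'' z \<beta>"
    and x: "x \<in> carrier (new_part_ext d f z)"
  shows "new_part_ext_map d f'' z \<beta> (new_part_ext_map d f' z \<alpha> x) = new_part_ext_map d f'' z (\<beta> \<circ> \<alpha>) x"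
proof -
  note a = module_map_new_part[OF d \<alpha>, where 'l='l] and b = module_map_new_part[OF d \<beta>, where 'l='l]
  have "jacobian_tate_map d f'' \<beta> (jacobian_tate_map d f' \<alpha> y) = jacobian_tate_map d f'' (\<beta> \<circ> \<alpha>) y"
    if "y \<in> carrier (new_part d f z :: ('l ladic_rat, _) module)" for y
    using that by (intro jacobian_tate_map_comp[OF equivariant_isoD[OF \<alpha>] equivariant_isoD[OF \<beta>]])
      (simp add: carrier_new_part)
  then have "base_change_map to_ac (new_part d f'' z) (jacobian_tate_map d f'' \<beta> \<circ> jacobian_tate_map d f' \<alpha>) x
      = base_change_map to_ac (new_part d f'' z) (jacobian_tate_map d f'' (\<beta> \<circ> \<alpha>)) x"
    using module_map_comp[OF a b] module_map_new_part[OF d equivariant_iso_comp[OF \<alpha> \<beta>], where 'l='l] x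
    by (intro base_change_map_cong[where M = "new_part d f z"]) (simp_all add: new_part_ext_def)
  then show ?thesis
    using base_change_map_comp[OF a b, of x to_ac] x by (simp add: new_part_ext_def new_part_ext_map_def)
qed

lemma new_part_ext_map_id:
  fixes x :: "('k::field, 'l::prime_card) tate_vector"
  assumes d: "d > 0" "z ^ d = 1" and x: "x \<in> carrier (new_part_ext d f z)"
  shows "new_part_ext_map d f z (\<lambda>g. g) x = x"
proof -
  have id: "equivariant_iso d f f z (\<lambda>g. g)"
    using equivariant_iso_scale_y[OF d(1), of 1 f f z] by (simp add: scale_y_one[abs_def])
  have "jacobian_tate_map d f (\<lambda>g. g) y = y"
    if "y \<in> carrier (new_part d f z :: ('l ladic_rat, _) module)" for y
    using that by (intro jacobian_tate_map_id equivariant_isoD[OF id]) (simp add: carrier_new_part)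
  then show ?thesis
    using base_change_map_id[OF module_map_new_part[OF d id], of x to_ac] x
    by (simp add: new_part_ext_def new_part_ext_map_def)
qed

section \<open>Eigenspaces of \<open>t\<close>\<close>

definition eigenspace ::
    "nat \<Rightarrow> 'k::field poly \<Rightarrow> 'k \<Rightarrow> 'l::prime_card ladic_closure \<Rightarrow> ('k, 'l) tate_vector set" where
  "eigenspace d f z e = {x \<in> carrier (new_part_ext d f z).
     new_part_ext_map d f z (mu_action z) x = e \<odot>\<^bsub>new_part_ext d f z\<^esub> x}"

lemma new_eigen_rep_simps:
  "carrier (fst (new_eigen_rep d f z e)) = eigenspace d f z e"
  "add (fst (new_eigen_rep d f z e)) = add (new_part_ext d f z)"
  "module.smult (fst (new_eigen_rep d f z e)) = module.smult (new_part_ext d f z)"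
  "snd (new_eigen_rep d f z e) \<sigma> = new_part_ext_map d f z (galois_action \<sigma>)"
  by (simp_all add: new_eigen_rep_def Let_def eigenspace_def)

lemma eigenspace_map:
  fixes e :: "'l::prime_card ladic_closure"
  assumes d: "d > 0" "z ^ d = 1" and \<alpha>: "equivariant_iso d f f' z \<alpha>" and x: "x \<in> eigenspace d f z e"
  shows "new_part_ext_map d f' z \<alpha> x \<in> eigenspace d f' z e"
proof -
  note m = module_map_new_part_ext[OF d \<alpha>]
  note mu = equivariant_iso_mu_action[OF d]
  have x': "x \<in> carrier (new_part_ext d f z)"
    and ev: "new_part_ext_map d f z (mu_action z) x = e \<odot>\<^bsub>new_part_ext d f z\<^esub> x"
    using x by (auto simp: eigenspace_def)
  have "new_part_ext_map d f' z (mu_action z) (new_part_ext_map d f' z \<alpha> x)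
      = new_part_ext_map d f' z (mu_action z \<circ> \<alpha>) x"
    by (rule new_part_ext_map_comp[OF d \<alpha> mu x'])
  also have "\<dots> = new_part_ext_map d f' z \<alpha> (new_part_ext_map d f z (mu_action z) x)"
    using new_part_ext_map_comp[OF d mu \<alpha> x'] \<alpha> by (simp add: equivariant_iso_def)
  also have "\<dots> = e \<odot>\<^bsub>new_part_ext d f' z\<^esub> new_part_ext_map d f' z \<alpha> x"
    by (simp add: ev module_mapD(3)[OF m x'])
  finally show ?thesis
    using module_mapD(1)[OF m x'] by (simp add: eigenspace_def)
qed

text \<open>Here an automorphism of the curve turns into a scalar: the discrepancy between Galois
  and the isomorphism is a power of \<open>t\<close>, and this makes it visible as a character
  value.\<close>

lemma eigenspace_mu_power:
  assumes d: "d > 0" "z ^ d = 1" and x: "x \<in> eigenspace d f z e"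
  shows "new_part_ext_map d f z (mu_action (z ^ j)) x = e ^ j \<odot>\<^bsub>new_part_ext d f z\<^esub> x"
proof (induction j)
  have x': "x \<in> carrier (new_part_ext d f z)"
    and ev: "new_part_ext_map d f z (mu_action z) x = e \<odot>\<^bsub>new_part_ext d f z\<^esub> x"
    using x by (auto simp: eigenspace_def)
  {
    case 0
    have "mu_action (1::'a) = (\<lambda>g. g)"
      by (simp add: fun_eq_iff mu_action_scale_y scale_y_one)
    then show ?case
      using new_part_ext_map_id[OF d x'] x' by (simp add: new_part_ext_def base_change_smult_one)
  next
    case (Suc j)
    have "(z ^ j) ^ d = 1" using d(2) by (metis power_commutes power_mult power_one mult.commute)
    note mj = equivariant_iso_mu_action[OF d(1) this, of f z]
    note m1 = equivariant_iso_mu_action[OF d, of f z]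
    have "mu_action (z ^ Suc j) = mu_action z \<circ> mu_action (z ^ j)"
      by (simp add: fun_eq_iff mu_action_scale_y scale_y_scale_y)
    then have "new_part_ext_map d f z (mu_action (z ^ Suc j)) x
        = new_part_ext_map d f z (mu_action z) (e ^ j \<odot>\<^bsub>new_part_ext d f z\<^esub> x)"
      using new_part_ext_map_comp[OF d mj m1 x'] Suc.IH by simp
    also have "\<dots> = e ^ j \<odot>\<^bsub>new_part_ext d f z\<^esub> (e \<odot>\<^bsub>new_part_ext d f z\<^esub> x)"
      by (simp add: module_mapD(3)[OF module_map_new_part_ext[OF d m1] x'] ev)
    also have "\<dots> = e ^ Suc j \<odot>\<^bsub>new_part_ext d f z\<^esub> x"
      using x' by (simp add: new_part_ext_def base_change_smult_smult mult.commute)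
    finally show ?case .
  }
qed

text \<open>The exponent \<open>j\<close> in the hypothesis on \<open>\<psi>\<close> is the bridge
  between the two fields: on the side of K it measures how \<open>\<sigma>\<close> moves
  \<open>\<delta>\<close>, on the l-adic side it gives the power of the eigenvalue
  \<open>e\<close>.\<close>

theorem rep_iso_twist:
  fixes f :: "'k::field poly" and e :: "'l::prime_card ladic_closure"
  assumes d: "d > 0" "z ^ d = 1" and c: "c \<noteq> 0" "\<delta> ^ d = to_ac c"
    and \<psi>: "\<And>\<sigma>. \<sigma> \<in> carrier absolute_galois_group \<Longrightarrow> \<exists>j. \<sigma> \<delta> = to_ac z ^ j * \<delta> \<and> \<psi> \<sigma> = e ^ j"
  shows "rep_iso absolute_galois_group (new_eigen_rep d f z e)
    (twist (new_eigen_rep d (smult c f) z e) \<psi>)"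
proof -
  let ?f' = "smult c f"
  let ?V = "new_part_ext d f z :: ('l ladic_closure, _) module"
  let ?V' = "new_part_ext d ?f' z :: ('l ladic_closure, _) module"
  have \<delta>: "\<delta> \<noteq> 0" using c d(1) by (auto simp: zero_power)
  have f': "map_poly to_ac ?f' = smult (\<delta> ^ d) (map_poly to_ac f)"
    by (rule poly_eqI) (simp add: coeff_map_poly c(2))
  \<comment> \<open>The factor is inverse to \<open>\<delta>\<close> because \<open>f\<close> is
    \<open>inverse \<delta> ^ d\<close> times \<open>c f\<close>.\<close>
  have \<Phi>: "equivariant_iso d f ?f' z (scale_y (inverse \<delta>))"
    and \<Psi>: "equivariant_iso d ?f' f z (scale_y \<delta>)"
    using \<delta> by (auto intro!: equivariant_iso_scale_y d(1) simp: f' power_inverse)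
  define \<phi> where "\<phi> = (new_part_ext_map d ?f' z (scale_y (inverse \<delta>)) :: ('k, 'l) tate_vector \<Rightarrow> _)"
  define \<phi>' where "\<phi>' = (new_part_ext_map d f z (scale_y \<delta>) :: ('k, 'l) tate_vector \<Rightarrow> _)"
  note m = module_map_new_part_ext[OF d \<Phi>, where 'l='l, folded \<phi>_def]
  have car: "x \<in> carrier (new_part_ext d g z)" if "x \<in> eigenspace d g z e" for x g
    using that by (simp add: eigenspace_def)
  have id: "scale_y \<delta> \<circ> scale_y (inverse \<delta>) = (\<lambda>g. g)" "scale_y (inverse \<delta>) \<circ> scale_y \<delta> = (\<lambda>g. g)"
    by (simp_all add: fun_eq_iff scale_y_scale_y \<delta> scale_y_one)
  have "bij_betw \<phi> (eigenspace d f z e) (eigenspace d ?f' z e)"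
  proof (rule bij_betw_byWitness[where f' = \<phi>'])
    show "\<forall>x\<in>eigenspace d f z e. \<phi>' (\<phi> x) = x"
      using new_part_ext_map_comp[OF d \<Phi> \<Psi>, where 'l='l] new_part_ext_map_id[OF d, where 'l='l] car
      by (simp add: \<phi>_def \<phi>'_def id)
    show "\<forall>x\<in>eigenspace d ?f' z e. \<phi> (\<phi>' x) = x"
      using new_part_ext_map_comp[OF d \<Psi> \<Phi>, where 'l='l] new_part_ext_map_id[OF d, where 'l='l] car
      by (simp add: \<phi>_def \<phi>'_def id)
    show "\<phi> ` eigenspace d f z e \<subseteq> eigenspace d ?f' z e" "\<phi>' ` eigenspace d ?f' z e \<subseteq> eigenspace d f z e"
      using eigenspace_map[OF d \<Phi>, where e=e] eigenspace_map[OF d \<Psi>, where e=e] by (auto simp: \<phi>_def \<phi>'_def)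
  qed
  moreover have "\<phi> (new_part_ext_map d f z (galois_action \<sigma>) x) =
      \<psi> \<sigma> \<odot>\<^bsub>?V'\<^esub> new_part_ext_map d ?f' z (galois_action \<sigma>) (\<phi> x)"
    if \<sigma>: "\<sigma> \<in> carrier absolute_galois_group" and x: "x \<in> eigenspace d f z e" for \<sigma> x
  proof -
    have ga: "galois_auto \<sigma>" and ra: "ring_auto \<sigma>"
      using absolute_galois_groupD[OF \<sigma>] by (auto simp: galois_auto_def)
    obtain j where j: "\<sigma> \<delta> = to_ac z ^ j * \<delta>" "\<psi> \<sigma> = e ^ j" using \<psi>[OF \<sigma>] by blast
    have z0: "z \<noteq> 0" using d by (auto simp: zero_power)
    \<comment> \<open>\<open>\<sigma>\<close> multiplies the inverse of \<open>\<delta>\<close> by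
      the inverse root of unity, so the correcting factor on the curve is \<open>z ^ j\<close> with
      positive exponent.\<close>
    have "\<sigma> (inverse \<delta>) * \<sigma> \<delta> = 1"
      using \<delta> by (simp flip: ring_autoD(2)[OF ra] add: ring_autoD(4)[OF ra])
    then have inv: "to_ac z ^ j * \<sigma> (inverse \<delta>) = inverse \<delta>"
      using \<delta> by (simp add: j(1) field_simps)
    have zj: "(z ^ j) ^ d = 1" using d(2) by (metis power_commutes power_mult power_one mult.commute)
    note g = equivariant_iso_galois_action[OF d(1) ga, of _ z]
    note mj = equivariant_iso_mu_action[OF d(1) zj, of ?f' z]
    \<comment> \<open>Both sides are Galois followed by one rescaling, by
      \<open>inverse \<delta>\<close> on the left and by \<open>z ^ j\<close> times
      \<open>\<sigma> (inverse \<delta>)\<close> on the right; these factors agree by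
      \<open>inv\<close>.\<close>
    have "scale_y (inverse \<delta>) \<circ> galois_action \<sigma> =
        mu_action (z ^ j) \<circ> (galois_action \<sigma> \<circ> scale_y (inverse \<delta>))"
      by (simp add: fun_eq_iff galois_action_scale_y[OF ra] mu_action_scale_y scale_y_scale_y inv)
    then have "\<phi> (new_part_ext_map d f z (galois_action \<sigma>) x) = new_part_ext_map d ?f' z
        (mu_action (z ^ j)) (new_part_ext_map d ?f' z (galois_action \<sigma>) (\<phi> x))"
      using new_part_ext_map_comp[OF d g \<Phi> car[OF x]]
        new_part_ext_map_comp[OF d \<Phi> g car[OF x]]
        new_part_ext_map_comp[OF d equivariant_iso_comp[OF \<Phi> g] mj car[OF x]]
      by (simp add: \<phi>_def)
    \<comment> \<open>\<open>\<phi>\<close> and Galois preserve the eigenspaces, so the vector on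
      which \<open>t\<close> is applied \<open>j\<close> times still has eigenvalue
      \<open>e\<close>.\<close>
    also have "\<dots> = e ^ j \<odot>\<^bsub>?V'\<^esub> new_part_ext_map d ?f' z (galois_action \<sigma>) (\<phi> x)"
      using eigenspace_mu_power[OF d eigenspace_map[OF d g eigenspace_map[OF d \<Phi> x]]]
      by (simp add: \<phi>_def)
    finally show ?thesis by (simp add: j(2))
  qed
  ultimately show ?thesis
    unfolding rep_iso_def twist_def
    using module_mapD(2,3)[OF m] car
    by (intro exI[of _ \<phi>]) (simp add: new_eigen_rep_simps)
qed

section \<open>The Galois group of \<open>K(\<gamma>)\<close>\<close>

text \<open>The first \<open>n\<close> powers are distinct roots of \<open>X^n - 1\<close>, which
  has at most \<open>n\<close> roots, so they are all of them.\<close>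

lemma primitive_root_of_unity_powers:
  fixes \<zeta> :: "'a::field"
  assumes prim: "primitive_root_of_unity n \<zeta>" and n: "n > 0" and x: "x ^ n = 1"
  shows "\<exists>j. x = \<zeta> ^ j"
proof -
  let ?p = "monom 1 n - 1 :: 'a poly"
  let ?R = "{x. poly ?p x = 0}"
  have roots: "poly ?p y = 0 \<longleftrightarrow> y ^ n = 1" for y by (simp add: poly_monom)
  have deg: "degree ?p = n"
    using n by (subst diff_conv_add_uminus, subst degree_add_eq_left) (simp_all add: degree_monom_eq)
  then have nz: "?p \<noteq> 0" using n by auto
  have z0: "\<zeta> \<noteq> 0" using prim n by (auto simp: primitive_root_of_unity_def zero_power)
  have "inj_on (\<lambda>j. \<zeta> ^ j) {..<n}"
  proof (rule linorder_inj_onI)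
    fix i j :: nat assume ij: "i < j" "i \<in> {..<n}" "j \<in> {..<n}"
    have "\<zeta> ^ j = \<zeta> ^ i * \<zeta> ^ (j - i)" using ij by (simp flip: power_add)
    then show "\<zeta> ^ i \<noteq> \<zeta> ^ j" using ij prim z0 by (auto simp: primitive_root_of_unity_def)
  qed auto
  then have "card ((\<lambda>j. \<zeta> ^ j) ` {..<n}) = n" by (simp add: card_image)
  moreover have "(\<zeta> ^ j) ^ n = 1" for j
    using prim by (metis power_commuting_commutes power_one primitive_root_of_unity_def power_mult mult.commute)
  then have "(\<lambda>j. \<zeta> ^ j) ` {..<n} \<subseteq> ?R"
    unfolding roots by blast
  ultimately have "(\<lambda>j. \<zeta> ^ j) ` {..<n} = ?R"
    using card_poly_roots_bound[OF nz] poly_roots_finite[OF nz] deg by (intro card_seteq) auto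
  then show ?thesis using x roots by blast
qed

lemma primitive_root_of_unity_to_ac:
  "primitive_root_of_unity n \<zeta> \<Longrightarrow> primitive_root_of_unity n (to_ac \<zeta>)"
  unfolding primitive_root_of_unity_def by (metis to_ac_1 to_ac_eq_iff to_ac_power)

text \<open>The group laws are used when \<open>\<chi>\<close> is evaluated along
  \<open>generate\<close>, where inverses occur.\<close>

lemma group_galois_group:
  assumes "ring E" "k \<subseteq> carrier E"
  shows "group (galois_group E k)"
proof -
  interpret ring E by fact
  let ?H = "{\<sigma> \<in> Bij (carrier E). \<sigma> \<in> Ring.ring_hom E E \<and> (\<forall>a\<in>k. \<sigma> a = a)}"
  have "subgroup ?H (BijGroup (carrier E))"
  proof (rule subgroup.intro)
    show "?H \<subseteq> carrier (BijGroup (carrier E))" by (auto simp: BijGroup_def)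
    show "x \<otimes>\<^bsub>BijGroup (carrier E)\<^esub> y \<in> ?H" if "x \<in> ?H" "y \<in> ?H" for x y
      using that assms(2) by (auto simp: BijGroup_def compose_Bij compose_eq Ring.ring_hom_def subset_iff Pi_iff)
    show "\<one>\<^bsub>BijGroup (carrier E)\<^esub> \<in> ?H"
      using assms(2) by (auto simp: BijGroup_def id_Bij Ring.ring_hom_def)
    fix x assume x: "x \<in> ?H"
    then have B: "x \<in> Bij (carrier E)" and h: "x \<in> Ring.ring_hom E E" and k: "\<And>a. a \<in> k \<Longrightarrow> x a = a"
      by auto
    have inj: "inj_on x (carrier E)" using B by (simp add: Bij_def bij_betw_def)
    have i: "inv_into (carrier E) x a = b" if "b \<in> carrier E" "x b = a" for a b
      using inv_into_f_eq[OF inj that] .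
    have "inv_into (carrier E) x (a \<otimes>\<^bsub>E\<^esub> b) = inv_into (carrier E) x a \<otimes>\<^bsub>E\<^esub> inv_into (carrier E) x b"
      "inv_into (carrier E) x (a \<oplus>\<^bsub>E\<^esub> b) = inv_into (carrier E) x a \<oplus>\<^bsub>E\<^esub> inv_into (carrier E) x b"
      if "a \<in> carrier E" "b \<in> carrier E" for a b
      by (rule Bij_inv_into_lemma[OF _ B _ that]; use h in \<open>auto simp: Ring.ring_hom_def\<close>)+
    moreover have "inv_into (carrier E) x a = a" if "a \<in> k" for a
      using i k that assms(2) by blast
    moreover have "inv_into (carrier E) x \<one>\<^bsub>E\<^esub> = \<one>\<^bsub>E\<^esub>"
      using i h by (simp add: Ring.ring_hom_def)
    ultimately show "inv\<^bsub>BijGroup (carrier E)\<^esub> x \<in> ?H"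
      using B assms(2) restrict_inv_into_Bij[OF B] Bij_inv_into_mem[OF B]
      by (simp add: inv_BijGroup Ring.ring_hom_def subset_iff)
  qed
  then show ?thesis
    unfolding galois_group_def by (rule subgroup.subgroup_is_group[OF _ group_BijGroup])
qed

section \<open>The extension generated by \<open>\<gamma>\<close> and restriction to it\<close>

lemma ring_of_type_algebra_simps [simp]:
  "carrier (ring_of_type_algebra :: 'a::comm_ring_1 ring) = UNIV"
  "monoid.mult (ring_of_type_algebra :: 'a::comm_ring_1 ring) = (*)"
  "monoid.one (ring_of_type_algebra :: 'a::comm_ring_1 ring) = 1"
  "ring.zero (ring_of_type_algebra :: 'a::comm_ring_1 ring) = 0"
  "ring.add (ring_of_type_algebra :: 'a::comm_ring_1 ring) = (+)"
  by (simp_all add: ring_of_type_algebra_def)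

lemma subring_base_field: "subring (base_field :: 'k::field alg_closure set) ring_of_type_algebra"
proof -
  interpret ring "ring_of_type_algebra :: 'k alg_closure ring" by (rule ring_from_type_algebra)
  have neg: "a_inv (ring_of_type_algebra :: 'k alg_closure ring) x = - x" for x
    by (rule minus_equality[symmetric, THEN sym]) simp_all
  show ?thesis
    by (rule subringI)
       (auto simp: base_field_def neg simp flip: to_ac_minus to_ac_mult to_ac_add
          intro: range_eqI[of _ _ 1])
qed

lemma subring_adjoin: "subring (adjoin \<gamma>) ring_of_type_algebra"
proof -
  interpret field "ring_of_type_algebra :: 'a alg_closure ring" by (rule field_from_type_algebra)
  show ?thesis unfolding adjoin_def
    by (rule simple_extension_is_subring[OF subring_base_field]) simp
qed

lemma adjoin_closed:
  "x \<in> adjoin \<gamma> \<Longrightarrow> y \<in> adjoin \<gamma> \<Longrightarrow> x + y \<in> adjoin \<gamma>"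
  "x \<in> adjoin \<gamma> \<Longrightarrow> y \<in> adjoin \<gamma> \<Longrightarrow> x * y \<in> adjoin \<gamma>"
  "1 \<in> adjoin \<gamma>" "\<gamma> \<in> adjoin \<gamma>" "base_field \<subseteq> adjoin \<gamma>"
proof -
  interpret ring "ring_of_type_algebra :: 'a alg_closure ring" by (rule ring_from_type_algebra)
  note s = subringE[OF subring_adjoin[of \<gamma>]]
  show "x \<in> adjoin \<gamma> \<Longrightarrow> y \<in> adjoin \<gamma> \<Longrightarrow> x + y \<in> adjoin \<gamma>"
    "x \<in> adjoin \<gamma> \<Longrightarrow> y \<in> adjoin \<gamma> \<Longrightarrow> x * y \<in> adjoin \<gamma>" "1 \<in> adjoin \<gamma>"
    using s by simp_all
  show "\<gamma> \<in> adjoin \<gamma>" "base_field \<subseteq> adjoin \<gamma>"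
    unfolding adjoin_def using simple_extension_mem[OF subring_base_field]
      simple_extension_incl[of base_field \<gamma>] by simp_all
qed

lemma group_relative_galois_group: "group (relative_galois_group (adjoin \<gamma>))"
proof -
  interpret ring "ring_of_type_algebra :: 'a alg_closure ring" by (rule ring_from_type_algebra)
  show ?thesis
    unfolding relative_galois_group_def
    by (rule group_galois_group[OF subring_is_ring[OF subring_adjoin]]) (simp add: adjoin_closed(5))
qed

text \<open>\<open>simple_extension\<close> builds its elements in Horner form in
  \<open>\<gamma>\<close> over K. As \<open>\<tau>\<close> fixes the coefficients, only the image of
  \<open>\<gamma>\<close> matters.\<close>

lemma galois_auto_adjoin:
  assumes \<tau>: "galois_auto \<tau>" and "\<tau> \<gamma> \<in> adjoin \<gamma>" and x: "x \<in> adjoin \<gamma>"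
  shows "\<tau> x \<in> adjoin \<gamma>"
proof -
  interpret ring "ring_of_type_algebra :: 'a alg_closure ring" by (rule ring_from_type_algebra)
  have r: "ring_auto \<tau>" using \<tau> by (simp add: galois_auto_def)
  have K: "\<tau> a = a" if "a \<in> base_field" for a
    using \<tau> that by (auto simp: galois_auto_def base_field_def)
  have "x \<in> simple_extension base_field \<gamma>" using x by (simp add: adjoin_def)
  then show ?thesis
  proof (induction rule: simple_extension.induct)
    case zero
    then show ?case using simple_extension.zero[of base_field \<gamma>] by (simp add: adjoin_def ring_autoD[OF r])
  next
    case (lin k1 k2)
    then show ?case
      using assms(2) adjoin_closed(5)[of \<gamma>]
      by (auto simp: ring_autoD[OF r] K intro!: adjoin_closed(1,2))
  qed
qed

text \<open>The restriction must be onto as well. Since \<open>\<tau>\<close> multiplies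
  \<open>\<gamma>\<close> by an element of K, its inverse multiplies \<open>\<gamma>\<close> by the
  inverse element, so both maps preserve the extension.\<close>

lemma restrict_relative_galois_group:
  assumes \<tau>: "galois_auto \<tau>" and \<tau>\<gamma>: "\<tau> \<gamma> = to_ac w * \<gamma>" and w: "w \<noteq> 0"
  shows "restrict \<tau> (adjoin \<gamma>) \<in> carrier (relative_galois_group (adjoin \<gamma>))"
proof -
  have K: "to_ac a \<in> adjoin \<gamma>" for a
    using adjoin_closed(5)[of \<gamma>] by (auto simp: base_field_def)
  have r: "ring_auto \<tau>" using \<tau> by (simp add: galois_auto_def)
  let ?i = "inv_into UNIV \<tau>"
  note ri = ring_auto_inv[OF r]
  have i: "galois_auto ?i"
    using \<tau> ri ring_autoD(10)[OF r] by (metis galois_auto_def)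
  have "\<gamma> = ?i (to_ac w * \<gamma>)" using ring_autoD(10)[OF r, of \<gamma>] by (simp add: \<tau>\<gamma>)
  then have "\<gamma> = to_ac w * ?i \<gamma>" using i by (simp add: ring_autoD(2)[OF ri] galois_auto_def)
  then have "?i \<gamma> = to_ac (inverse w) * \<gamma>"
    using w by (simp add: field_simps)
  then have "?i \<gamma> \<in> adjoin \<gamma>" "\<tau> \<gamma> \<in> adjoin \<gamma>"
    using \<tau>\<gamma> by (simp_all add: adjoin_closed(2,4) K del: to_ac_inverse)
  then have cl: "x \<in> adjoin \<gamma> \<Longrightarrow> ?i x \<in> adjoin \<gamma>" "x \<in> adjoin \<gamma> \<Longrightarrow> \<tau> x \<in> adjoin \<gamma>" for x
    using galois_auto_adjoin[OF i] galois_auto_adjoin[OF \<tau>] by blast+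
  have "bij_betw \<tau> (adjoin \<gamma>) (adjoin \<gamma>)"
    by (rule bij_betw_byWitness[where f' = ?i]) (use cl ring_autoD(10,11)[OF r] in auto)
  then have "restrict \<tau> (adjoin \<gamma>) \<in> Bij (adjoin \<gamma>)"
    by (simp add: Bij_def cong: bij_betw_cong)
  then show ?thesis
    using \<tau> adjoin_closed(1,2)[of _ \<gamma>] adjoin_closed(3)[of \<gamma>] K cl
    by (auto simp: relative_galois_group_def galois_group_def Ring.ring_hom_def ring_autoD[OF r]
        galois_auto_def base_field_def)
qed

section \<open>The character on the relative Galois group\<close>

lemma relative_galois_groupD:
  assumes "\<rho> \<in> carrier (relative_galois_group L)"
  shows "x \<in> L \<Longrightarrow> \<rho> x \<in> L" "x \<in> L \<Longrightarrow> y \<in> L \<Longrightarrow> \<rho> (x * y) = \<rho> x * \<rho> y"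
    "\<rho> (to_ac a) = to_ac a"
  using assms
  by (auto simp: relative_galois_group_def galois_group_def Ring.ring_hom_def base_field_def)

lemma relative_galois_group_mult:
  assumes "\<rho> \<in> carrier (relative_galois_group L)" "\<rho>' \<in> carrier (relative_galois_group L)" "x \<in> L"
  shows "(\<rho> \<otimes>\<^bsub>relative_galois_group L\<^esub> \<rho>') x = \<rho> (\<rho>' x)"
  using assms by (auto simp: relative_galois_group_def galois_group_def BijGroup_def compose_eq)

lemma relative_galois_group_one: "x \<in> L \<Longrightarrow> \<one>\<^bsub>relative_galois_group L\<^esub> x = x"
  by (simp add: relative_galois_group_def galois_group_def BijGroup_def)

text \<open>Induction along words in \<open>\<sigma>\<close>, keeping one exponent for the action on
  \<open>\<gamma>\<close> and for the value of \<open>\<chi>\<close>. Two separate existence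
  statements would lose the link between \<open>\<zeta>\<close> and \<open>\<zeta>l\<close>.\<close>

lemma character_power:
  fixes \<zeta> :: "'k::field" and \<zeta>l :: "'e::field"
  assumes n: "n > 0" and \<zeta>: "\<zeta> ^ n = 1" "\<zeta>l ^ n = 1"
    and \<sigma>: "\<sigma> \<in> carrier (relative_galois_group (adjoin \<gamma>))" "\<sigma> \<gamma> = to_ac \<zeta> ^ m * \<gamma>"
    and gen: "carrier (relative_galois_group (adjoin \<gamma>)) = generate (relative_galois_group (adjoin \<gamma>)) {\<sigma>}"
    and \<chi>: "\<chi> \<in> hom (relative_galois_group (adjoin \<gamma>)) (units_of ring_of_type_algebra)" "\<chi> \<sigma> = \<zeta>l ^ m"
    and \<rho>: "\<rho> \<in> carrier (relative_galois_group (adjoin \<gamma>))"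
  shows "\<exists>j. \<rho> \<gamma> = to_ac \<zeta> ^ j * \<gamma> \<and> \<chi> \<rho> = \<zeta>l ^ j"
proof -
  let ?G = "relative_galois_group (adjoin \<gamma>)"
  interpret group ?G by (rule group_relative_galois_group)
  have \<gamma>: "\<gamma> \<in> adjoin \<gamma>" by (rule adjoin_closed(4))
  have pw: "to_ac a ^ j \<in> adjoin \<gamma>" for a j
    using adjoin_closed(5)[of \<gamma>] by (auto simp: base_field_def simp flip: to_ac_power)
  have \<chi>m: "\<chi> (x \<otimes>\<^bsub>?G\<^esub> y) = \<chi> x * \<chi> y" if "x \<in> carrier ?G" "y \<in> carrier ?G" for x y
    using \<chi>(1) that by (simp add: hom_def units_of_def)
  have \<chi>0: "\<chi> x \<noteq> 0" if "x \<in> carrier ?G" for x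
    using \<chi>(1) that by (auto simp: hom_def units_of_def Units_def Pi_iff)
  \<comment> \<open>The value at the identity is idempotent and, being a unit, nonzero.\<close>
  have \<chi>1: "\<chi> \<one>\<^bsub>?G\<^esub> = 1"
    using \<chi>m[of "\<one>\<^bsub>?G\<^esub>" "\<one>\<^bsub>?G\<^esub>"] \<chi>0[of "\<one>\<^bsub>?G\<^esub>"] by simp
  have act: "x (to_ac \<zeta> ^ j * \<gamma>) = to_ac \<zeta> ^ j * x \<gamma>" if "x \<in> carrier ?G" for x j
    using relative_galois_groupD(2,3)[OF that] pw \<gamma> by (simp flip: to_ac_power)
  have \<zeta>': "\<zeta> ^ (m * n) = 1" "\<zeta>l ^ (m * n) = 1"
    using \<zeta> by (simp_all add: power_mult mult.commute[of m])
  have "\<rho> \<in> generate ?G {\<sigma>}" using \<rho> gen by simp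
  then show ?thesis
  proof (induction rule: generate.induct)
    case one
    show ?case using relative_galois_group_one[OF \<gamma>] \<chi>1 by (intro exI[of _ 0]) simp
  next
    case (incl h)
    then show ?case using \<sigma>(2) \<chi>(2) by blast
  next
    case (inv h)
    then have h: "h = \<sigma>" by simp
    \<comment> \<open>Exponents are natural numbers, so the inverse of \<open>\<sigma>\<close>
      receives \<open>m * (n - 1)\<close>, which is \<open>-m\<close> modulo \<open>n\<close>; this
      is legitimate on both sides because both roots of unity have order dividing
      \<open>n\<close>.\<close>
    have mn: "m * (n - 1) + m = m * n" using n by (cases n) auto
    have ic: "inv\<^bsub>?G\<^esub> \<sigma> \<in> carrier ?G" using \<sigma>(1) by simp
    have "to_ac \<zeta> ^ m * (inv\<^bsub>?G\<^esub> \<sigma>) \<gamma> = (inv\<^bsub>?G\<^esub> \<sigma> \<otimes>\<^bsub>?G\<^esub> \<sigma>) \<gamma>"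
      using relative_galois_group_mult[OF ic \<sigma>(1) \<gamma>] act[OF ic] \<sigma>(2) by simp
    then have 1: "to_ac \<zeta> ^ m * (inv\<^bsub>?G\<^esub> \<sigma>) \<gamma> = \<gamma>"
      using relative_galois_group_one[OF \<gamma>] \<sigma>(1) by simp
    have "(inv\<^bsub>?G\<^esub> \<sigma>) \<gamma> = to_ac (\<zeta> ^ (m * n)) * (inv\<^bsub>?G\<^esub> \<sigma>) \<gamma>" by (simp only: \<zeta>') simp
    also have "\<dots> = to_ac \<zeta> ^ (m * (n - 1)) * (to_ac \<zeta> ^ m * (inv\<^bsub>?G\<^esub> \<sigma>) \<gamma>)"
      by (simp flip: mn add: power_add)
    finally have 2: "(inv\<^bsub>?G\<^esub> \<sigma>) \<gamma> = to_ac \<zeta> ^ (m * (n - 1)) * \<gamma>" unfolding 1 .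
    have 3: "\<chi> (inv\<^bsub>?G\<^esub> \<sigma>) * \<zeta>l ^ m = 1"
      using \<chi>m[OF ic \<sigma>(1)] \<chi>1 \<chi>(2) \<sigma>(1) by simp
    have "\<chi> (inv\<^bsub>?G\<^esub> \<sigma>) = \<chi> (inv\<^bsub>?G\<^esub> \<sigma>) * \<zeta>l ^ (m * n)" by (simp only: \<zeta>') simp
    also have "\<dots> = (\<chi> (inv\<^bsub>?G\<^esub> \<sigma>) * \<zeta>l ^ m) * \<zeta>l ^ (m * (n - 1))"
      by (simp flip: mn add: power_add)
    finally have "\<chi> (inv\<^bsub>?G\<^esub> \<sigma>) = \<zeta>l ^ (m * (n - 1))" unfolding 3 by simp
    then show ?case using 2 h by blast
  next
    case (eng h1 h2)
    then obtain j1 j2 where j: "h1 \<gamma> = to_ac \<zeta> ^ j1 * \<gamma>" "\<chi> h1 = \<zeta>l ^ j1"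
      "h2 \<gamma> = to_ac \<zeta> ^ j2 * \<gamma>" "\<chi> h2 = \<zeta>l ^ j2" by blast
    have c: "h1 \<in> carrier ?G" "h2 \<in> carrier ?G" using eng.hyps gen by auto
    \<comment> \<open>\<open>h1\<close> fixes the root of unity that \<open>h2\<close> produces,
      since it lies in K, so the exponents add.\<close>
    show ?case
      by (rule exI[of _ "j1 + j2"])
         (simp add: relative_galois_group_mult[OF c \<gamma>] \<chi>m[OF c] j act[OF c(1)], simp add: power_add)
  qed
qed

theorem lemma5p4:
  fixes v :: "'k::field \<Rightarrow> int"
    and p n d r i :: nat
    and f :: "'k poly"
    and c \<zeta> :: 'k
    and \<zeta>l :: "'l::prime_card ladic_closure"
    and \<gamma> :: "'k alg_closure"
    and L :: "'k alg_closure set"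
    and \<sigma> :: "'k alg_closure \<Rightarrow> 'k alg_closure"
    and \<chi> :: "('k alg_closure \<Rightarrow> 'k alg_closure) \<Rightarrow> 'l ladic_closure"
  assumes "complete_discrete_valuation v"
    and "residue_characteristic v p"
    and "n > 0" and "\<not> p dvd n"
    and "CARD('l) \<noteq> p"
    and "primitive_root_of_unity n \<zeta>"
    and "primitive_root_of_unity n \<zeta>l"
    and "degree f > 0"
    and "discriminant f \<noteq> 0"
    and "\<forall>x :: 'k alg_closure. poly (map_poly to_ac f) x = 0 \<longrightarrow> x \<in> range to_ac"
    and "c \<noteq> 0"
    and "d dvd n"
    and "\<gamma> ^ n = to_ac c"
    and "L = adjoin \<gamma>"
    and "r = extension_degree L"
    and "\<sigma> \<in> carrier (relative_galois_group L)"
    and "carrier (relative_galois_group L) = generate (relative_galois_group L) {\<sigma>}"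
    and "\<sigma> \<gamma> = to_ac \<zeta> ^ (n div r) * \<gamma>"
    and "\<chi> \<in> hom (relative_galois_group L) (units_of ring_of_type_algebra)"
    and "\<chi> \<sigma> = \<zeta>l ^ (n div r)"
    and "1 \<le> i" and "i \<le> n" and "coprime i n"
  shows "rep_iso absolute_galois_group
    (new_eigen_rep d f (\<zeta> ^ (n div d)) ((\<zeta>l ^ (n div d)) ^ i))
    (twist (new_eigen_rep d (Polynomial.smult c f) (\<zeta> ^ (n div d)) ((\<zeta>l ^ (n div d)) ^ i))
       (\<lambda>\<tau>. (\<chi> (restrict \<tau> L) ^ (n div d)) ^ i))"
proof -
  let ?q = "n div d"
  have n: "n > 0" and qd: "?q * d = n" and d: "d > 0"
    using assms(3,12) by (auto intro: dvd_pos_nat)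
  have \<zeta>: "\<zeta> ^ n = 1" "\<zeta>l ^ n = 1"
    using assms(6,7) by (auto simp: primitive_root_of_unity_def)
  have \<zeta>0: "\<zeta> \<noteq> 0" using \<zeta>(1) n by (auto simp: zero_power)
  have \<gamma>0: "\<gamma> \<noteq> 0" using assms(11,13) n by (auto simp: zero_power)
  show ?thesis
  proof (rule rep_iso_twist[where \<delta> = "\<gamma> ^ ?q", OF d _ assms(11)])
    show "(\<zeta> ^ ?q) ^ d = 1" by (simp add: qd \<zeta> flip: power_mult)
    show "(\<gamma> ^ ?q) ^ d = to_ac c" by (simp add: qd assms(13) flip: power_mult)
    fix \<tau> assume "\<tau> \<in> carrier (absolute_galois_group :: ('k alg_closure \<Rightarrow> 'k alg_closure) monoid)"
    then have \<tau>: "galois_auto \<tau>" by (rule absolute_galois_groupD)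
    then have ra: "ring_auto \<tau>" by (simp add: galois_auto_def)
    \<comment> \<open>Kummer theory: \<open>\<tau>\<close> fixes \<open>c\<close>, so
      \<open>\<tau> \<gamma>\<close> is another \<open>n\<close>-th root of \<open>c\<close> and
      differs from \<open>\<gamma>\<close> by a power of \<open>\<zeta>\<close>.\<close>
    have "\<tau> \<gamma> ^ n = \<gamma> ^ n"
      unfolding ring_autoD(6)[OF ra, symmetric] assms(13) using \<tau> by (simp add: galois_auto_def)
    then have "(\<tau> \<gamma> / \<gamma>) ^ n = 1" using \<gamma>0 by (simp add: power_divide)
    then obtain k where "\<tau> \<gamma> / \<gamma> = to_ac \<zeta> ^ k"
      using primitive_root_of_unity_powers[OF primitive_root_of_unity_to_ac[OF assms(6)] n] by blast
    then have "\<tau> \<gamma> = to_ac (\<zeta> ^ k) * \<gamma>" using \<gamma>0 by (simp add: field_simps)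
    then have "restrict \<tau> L \<in> carrier (relative_galois_group L)"
      unfolding assms(14) by (rule restrict_relative_galois_group[OF \<tau>]) (simp add: \<zeta>0)
    \<comment> \<open>The exponent \<open>k\<close> only served to show that \<open>\<tau>\<close>
      restricts to the extension. The exponent \<open>j\<close> agrees with it modulo
      \<open>n\<close> and in addition computes \<open>\<chi>\<close>.\<close>
    then obtain j where j: "restrict \<tau> L \<gamma> = to_ac \<zeta> ^ j * \<gamma>" "\<chi> (restrict \<tau> L) = \<zeta>l ^ j"
      using character_power[OF n \<zeta> assms(16)[unfolded assms(14)] assms(18) assms(17)[unfolded assms(14)]
          assms(19)[unfolded assms(14)] assms(20)]
      unfolding assms(14) by blast
    have "\<tau> \<gamma> = to_ac \<zeta> ^ j * \<gamma>" using j(1) adjoin_closed(4)[of \<gamma>] by (simp add: assms(14))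
    \<comment> \<open>Passing to the power \<open>n div d\<close> turns \<open>\<gamma>\<close> into
      the \<open>d\<close>-th root \<open>\<delta>\<close> and \<open>\<zeta>\<close> into the root
      of unity by which \<open>t\<close> acts, with \<open>j\<close> unchanged.\<close>
    then have "\<tau> (\<gamma> ^ ?q) = to_ac (\<zeta> ^ ?q) ^ j * \<gamma> ^ ?q"
      by (simp add: ring_autoD(6)[OF ra] power_mult_distrib mult.commute flip: power_mult)
    moreover have "(\<chi> (restrict \<tau> L) ^ ?q) ^ i = ((\<zeta>l ^ ?q) ^ i) ^ j"
      by (simp add: j(2) mult_ac flip: power_mult)
    ultimately show "\<exists>j. \<tau> (\<gamma> ^ ?q) = to_ac (\<zeta> ^ ?q) ^ j * \<gamma> ^ ?q \<and>
        (\<chi> (restrict \<tau> L) ^ ?q) ^ i = ((\<zeta>l ^ ?q) ^ i) ^ j" by blast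
  qed
qed

end
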